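(* Let $p=2$, let $n$ be a positive integer and let $e\ge1$ be an integer. Consider the number of pairs of integers $(x,y)$ with $1\le x,y\le p^e$, $p\nmid x$, $p\nmid y$ satisfying $$x^{x^n}\equiv y\pmod{p^e}\quad\text{and}\quad y^{y^n}\equiv x\pmod{p^e}.$$ If $p\nmid n$, this number is, for all $e\ge1$, $$\begin{cases}1&\text{if } e=1,\\ 2p^{e-2}&\text{if } 2\le e\le4,\\ p^{\lfloor (e+1)/2\rfloor}+p^{\lfloor e/3\rfloor+\lfloor (e+1)/3\rfloor}&\text{if } e\ge5.\end{cases}$$ If $p\mid n$, this number is, for all $e\ge1$, $$\begin{cases}1&\text{if } e=1,\\ 2p^{e-2}&\text{if } 2\le e\le v_p(n)+4,\\ 2p^{\lfloor (e+v_p(n)+1)/2\rfloor}&\text{if } e\ge v_p(n)+5.\end{cases}$$ For all $n$, the only solutions $(x,y)\in\mathbb{Z}_p^2$ with $p\nmid x$, $p\nmid y$ to the equations $$\omega(x)\langle x\rangle^{x^n}=y\quad\text{and}\quad\omega(y)\langle y\rangle^{y^n}=x$$ are $(x,y)=(1,1)$ and $(x,y)=(-1,-1)$.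
   Context: Throughout $p=2$. $\mathbb{Z}_2$ is the ring of $2$-adic integers, $v_2$ the $2$-adic valuation. For $x\in\mathbb{Z}_2^\times$, $\omega(x)\in\{1,-1\}$ is determined by $\omega(x)\equiv x\pmod 4$, and $\langle x\rangle=x/\omega(x)\in 1+4\mathbb{Z}_2$; for $z\in\mathbb{Z}_2$, $\langle x\rangle^{z}=\exp(z\log\langle x\rangle)$. *)

theory Defs
  imports
    Complex_Main
    "HOL-Computational_Algebra.Fraction_Field"
    "HOL-Number_Theory.Cong"
begin

text \<open>The number of solutions of the congruences; positive \<open>x\<close>, \<open>y\<close> may be taken in \<open>nat\<close>.\<close>

definition num_solutions :: "nat \<Rightarrow> nat \<Rightarrow> nat" where
  "num_solutions n e = card {(x :: nat, y :: nat).
     x \<in> {1..2 ^ e} \<and> y \<in> {1..2 ^ e} \<and> \<not> 2 dvd x \<and> \<not> 2 dvd y \<and>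
     [x ^ (x ^ n) = y] (mod 2 ^ e) \<and> [y ^ (y ^ n) = x] (mod 2 ^ e)}"


section \<open>The ring of 2-adic integers\<close>

text \<open>
  The inverse limit of the rings of integers modulo \<open>2 ^ k\<close>, residue classes being
  represented by their least non-negative elements.
\<close>

typedef two_adic_int =
  "{f :: nat \<Rightarrow> int. (\<forall>k. f k \<in> {0..<2 ^ k}) \<and> (\<forall>k. [f (Suc k) = f k] (mod 2 ^ k))}"
  morphisms residue Abs_two_adic_int
  by (rule exI[of _ "\<lambda>_. 0"]) simp

setup_lifting type_definition_two_adic_int

lemma residue_bounds: "0 \<le> residue x k" "residue x k < 2 ^ k"
  using residue[of x] by auto

lemma residue_Suc: "[residue x (Suc k) = residue x k] (mod 2 ^ k)"
  using residue[of x] by auto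

lemma residue_mod [simp]: "residue x k mod 2 ^ k = residue x k"
  using residue_bounds[of x k] by simp

lemma residue_cong: "k \<le> m \<Longrightarrow> [residue x m = residue x k] (mod 2 ^ k)"
proof (induction m rule: dec_induct)
  case base
  show ?case by simp
next
  case (step m)
  have "[residue x (Suc m) = residue x m] (mod 2 ^ k)"
    using residue_Suc[of x m] step.hyps by (meson cong_dvd_modulus le_imp_power_dvd)
  with step.IH show ?case by (rule cong_trans[rotated])
qed

lemma residue_le_mod: "k \<le> m \<Longrightarrow> residue x m mod 2 ^ k = residue x k"
  using residue_cong[of k m x] by (simp add: cong_def)

lemma two_adic_int_eqI: "(\<And>k. residue x k = residue y k) \<Longrightarrow> x = y"
  by (metis residue_inject ext)

lemma cong_Suc_pow_mod:
  fixes a b :: int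
  assumes "[a = b] (mod 2 ^ k)"
  shows "[a mod 2 ^ Suc k = b] (mod 2 ^ k)"
  using assms unfolding cong_def
  by (metis le_imp_power_dvd lessI less_imp_le mod_mod_cancel)

instantiation two_adic_int :: comm_ring_1
begin

lift_definition zero_two_adic_int :: two_adic_int is "\<lambda>_. 0"
  by simp

lift_definition one_two_adic_int :: two_adic_int is "\<lambda>k. 1 mod 2 ^ k"
  by (auto intro: cong_Suc_pow_mod simp del: power_Suc)

lift_definition plus_two_adic_int :: "two_adic_int \<Rightarrow> two_adic_int \<Rightarrow> two_adic_int"
  is "\<lambda>f g k. (f k + g k) mod 2 ^ k"
  by (auto intro!: cong_Suc_pow_mod cong_add simp del: power_Suc)

lift_definition uminus_two_adic_int :: "two_adic_int \<Rightarrow> two_adic_int"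
  is "\<lambda>f k. (- f k) mod 2 ^ k"
  by (auto intro!: cong_Suc_pow_mod simp: cong_minus_minus_iff simp del: power_Suc)

lift_definition minus_two_adic_int :: "two_adic_int \<Rightarrow> two_adic_int \<Rightarrow> two_adic_int"
  is "\<lambda>f g k. (f k - g k) mod 2 ^ k"
  by (auto intro!: cong_Suc_pow_mod cong_diff simp del: power_Suc)

lift_definition times_two_adic_int :: "two_adic_int \<Rightarrow> two_adic_int \<Rightarrow> two_adic_int"
  is "\<lambda>f g k. (f k * g k) mod 2 ^ k"
  by (auto intro!: cong_Suc_pow_mod cong_mult simp del: power_Suc)

instance
proof
  fix a b c :: two_adic_int
  show "a + b + c = a + (b + c)"
    by transfer (auto simp: mod_simps algebra_simps)
  show "a + b = b + a"
    by transfer (auto simp: algebra_simps)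
  show "0 + a = a"
    by transfer auto
  show "- a + a = 0"
    by transfer (auto simp: mod_simps)
  show "a - b = a + - b"
    by transfer (auto simp: mod_simps)
  show "a * b * c = a * (b * c)"
    by transfer (auto simp: mod_simps algebra_simps)
  show "a * b = b * a"
    by transfer (auto simp: algebra_simps)
  show "1 * a = a"
  proof (rule two_adic_int_eqI)
    fix k
    show "residue (1 * a) k = residue a k"
      by transfer (simp add: mod_simps del: one_mod_2_pow_eq)
  qed
  show "(a + b) * c = a * c + b * c"
    by transfer (auto simp: mod_simps algebra_simps)
  show "(0 :: two_adic_int) \<noteq> 1"
    by transfer (auto simp: fun_eq_iff intro!: exI[of _ 1])
qed

end

lemma residue_0 [simp]: "residue 0 k = 0"
  by transfer simp

lemma residue_1: "residue 1 k = 1 mod 2 ^ k"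
  by transfer simp

lemma residue_add: "residue (x + y) k = (residue x k + residue y k) mod 2 ^ k"
  by transfer simp

lemma residue_mult: "residue (x * y) k = (residue x k * residue y k) mod 2 ^ k"
  by transfer simp

lemma residue_of_nat: "residue (of_nat n) k = int n mod 2 ^ k"
  by (induction n) (simp_all add: residue_add residue_1 mod_simps)

lemma two_power_dvd_iff: "2 ^ k dvd x \<longleftrightarrow> residue x k = 0"
proof
  have two_power: "residue (2 ^ k) m = 2 ^ k mod 2 ^ m" for m
    using residue_of_nat[of "2 ^ k" m] by simp
  show "residue x k = 0" if "2 ^ k dvd x"
    using that by (auto simp: residue_mult two_power)
  assume "residue x k = 0"
  then have dvd: "2 ^ k dvd residue x (m + k)" for m
    using residue_le_mod[of k "m + k" x] by (simp add: dvd_eq_mod_eq_0)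
  define y where "y = Abs_two_adic_int (\<lambda>m. residue x (m + k) div 2 ^ k)"
  have "residue x (m + k) div 2 ^ k \<in> {0..<2 ^ m}" for m
  proof -
    obtain a where a: "residue x (m + k) = 2 ^ k * a"
      using dvd by (meson dvdE)
    then show ?thesis
      using residue_bounds[of x "m + k"] by (simp add: power_add zero_le_mult_iff)
  qed
  moreover have "[residue x (Suc m + k) div 2 ^ k = residue x (m + k) div 2 ^ k] (mod 2 ^ m)" for m
  proof -
    obtain a b where ab: "residue x (Suc m + k) = 2 ^ k * a" "residue x (m + k) = 2 ^ k * b"
      using dvd by (meson dvdE)
    have "2 ^ (m + k) dvd residue x (Suc m + k) - residue x (m + k)"
      using residue_Suc[of x "m + k"] by (simp add: cong_iff_dvd_diff)
    moreover have "(2 :: int) ^ (m + k) = 2 ^ k * 2 ^ m" "2 ^ k * a - 2 ^ k * b = 2 ^ k * (a - b)"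
      by (simp_all add: power_add right_diff_distrib)
    ultimately have "2 ^ k * 2 ^ m dvd 2 ^ k * (a - b)"
      unfolding ab by simp
    then show ?thesis
      unfolding ab by (simp add: cong_iff_dvd_diff)
  qed
  ultimately have y: "residue y m = residue x (m + k) div 2 ^ k" for m
    unfolding y_def by (subst Abs_two_adic_int_inverse) auto
  have "x = 2 ^ k * y"
  proof (rule two_adic_int_eqI)
    fix m
    have "residue (2 ^ k * y) m = (2 ^ k * (residue x (m + k) div 2 ^ k)) mod 2 ^ m"
      by (simp add: residue_mult two_power y mod_simps)
    also have "\<dots> = residue x m"
      using dvd[of m] residue_le_mod[of m "m + k" x] by simp
    finally show "residue x m = residue (2 ^ k * y) m" ..
  qed
  then show "2 ^ k dvd x" by simp
qed

text \<open>The 2-adic valuation; its value at \<open>0\<close> is irrelevant.\<close>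

definition val2 :: "two_adic_int \<Rightarrow> nat" where
  "val2 x = (GREATEST k. 2 ^ k dvd x)"

lemma val2_props:
  assumes "x \<noteq> 0"
  shows "2 ^ val2 x dvd x" and "2 ^ k dvd x \<Longrightarrow> k \<le> val2 x"
proof -
  obtain m where m: "residue x m \<noteq> 0"
    using assms two_adic_int_eqI[of x 0] by auto
  have bound: "k \<le> m" if "2 ^ k dvd x" for k
    using that m residue_le_mod[of m k x] by (force simp: two_power_dvd_iff)
  show "2 ^ val2 x dvd x"
    unfolding val2_def by (rule GreatestI_nat[of _ 0 m]) (auto intro: bound)
  show "2 ^ k dvd x \<Longrightarrow> k \<le> val2 x"
    unfolding val2_def by (rule Greatest_le_nat[of _ _ m]) (auto intro: bound)
qed

lemma val2_eqI:
  assumes "2 ^ k dvd x" "\<not> 2 ^ Suc k dvd x"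
  shows "x \<noteq> 0" and "val2 x = k"
proof -
  show "x \<noteq> 0" using assms by auto
  then show "val2 x = k"
    using val2_props[of x] assms
    by (metis le_antisym not_less_eq_eq power_le_dvd)
qed

lemma residue_odd_part:
  assumes "x \<noteq> 0" "val2 x < m"
  obtains a where "odd a" "residue x m = 2 ^ val2 x * a"
proof -
  have "2 ^ val2 x dvd residue x m"
    using val2_props(1)[OF assms(1)] residue_le_mod[of "val2 x" m x] assms(2)
    by (simp add: two_power_dvd_iff dvd_eq_mod_eq_0)
  then obtain a where a: "residue x m = 2 ^ val2 x * a" by (rule dvdE)
  moreover have "odd a"
  proof
    assume "even a"
    then have "2 ^ Suc (val2 x) dvd residue x m"
      by (auto simp: a)
    then have "residue x (Suc (val2 x)) = 0"
      using residue_le_mod[of "Suc (val2 x)" m x] assms(2) by (simp add: dvd_eq_mod_eq_0)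
    then show False
      using val2_props(2)[OF assms(1), of "Suc (val2 x)"] by (simp add: two_power_dvd_iff del: power_Suc)
  qed
  ultimately show ?thesis using that by blast
qed

lemma mult_nonzero_val2:
  fixes x y :: two_adic_int
  assumes "x \<noteq> 0" "y \<noteq> 0"
  shows "x * y \<noteq> 0" and "val2 (x * y) = val2 x + val2 y"
proof -
  let ?m = "Suc (val2 x + val2 y)"
  obtain a where a: "odd a" "residue x ?m = 2 ^ val2 x * a"
    using residue_odd_part[OF assms(1), of ?m] by auto
  obtain b where b: "odd b" "residue y ?m = 2 ^ val2 y * b"
    using residue_odd_part[OF assms(2), of ?m] by auto
  have "residue (x * y) ?m = (2 ^ (val2 x + val2 y) * (a * b)) mod 2 ^ ?m"
    by (simp add: residue_mult a b power_add mult_ac del: power_Suc)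
  moreover have "\<not> 2 ^ ?m dvd 2 ^ (val2 x + val2 y) * (a * b)"
    using a(1) b(1) by simp
  ultimately have "\<not> 2 ^ ?m dvd x * y"
    by (simp add: two_power_dvd_iff dvd_eq_mod_eq_0 del: power_Suc)
  moreover have "2 ^ (val2 x + val2 y) dvd x * y"
    using val2_props(1)[OF assms(1)] val2_props(1)[OF assms(2)]
    by (simp add: power_add mult_dvd_mono)
  ultimately show "x * y \<noteq> 0" "val2 (x * y) = val2 x + val2 y"
    using val2_eqI by blast+
qed

instance two_adic_int :: idom
  by standard (rule mult_nonzero_val2(1))


section \<open>The field of 2-adic numbers and its topology\<close>

class valued_idom = idom +
  fixes absval :: "'a \<Rightarrow> real"
  assumes absval_nonneg: "0 \<le> absval x"
    and absval_eq_0_iff [simp]: "absval x = 0 \<longleftrightarrow> x = 0"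
    and absval_mult: "absval (x * y) = absval x * absval y"
    and absval_add_le_max: "absval (x + y) \<le> max (absval x) (absval y)"
begin

lemma absval_0 [simp]: "absval 0 = 0"
  by simp

lemma absval_1 [simp]: "absval 1 = 1"
  using absval_mult[of 1 1] by simp

lemma absval_minus [simp]: "absval (- x) = absval x"
proof -
  have "absval (- 1) ^ 2 = 1"
    using absval_mult[of "- 1" "- 1"] by (simp add: monoid_mult_class.power2_eq_square)
  then have "absval (- 1) = 1"
    using absval_nonneg[of "- 1"] by (simp add: linordered_idom_class.abs_square_eq_1)
  then show ?thesis
    using absval_mult[of "- 1" x] by simp
qed

end

instantiation two_adic_int :: valued_idom
begin

definition absval_two_adic_int :: "two_adic_int \<Rightarrow> real" where
  "absval_two_adic_int x = (if x = 0 then 0 else (1 / 2) ^ val2 x)"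

instance
proof
  fix x y :: two_adic_int
  show "0 \<le> absval x"
    by (simp add: absval_two_adic_int_def)
  show "absval x = 0 \<longleftrightarrow> x = 0"
    by (simp add: absval_two_adic_int_def)
  show "absval (x * y) = absval x * absval y"
    using mult_nonzero_val2[of x y] by (auto simp: absval_two_adic_int_def power_add)
  show "absval (x + y) \<le> max (absval x) (absval y)"
  proof (cases "x = 0 \<or> y = 0 \<or> x + y = 0")
    case True
    then show ?thesis by (auto simp: absval_two_adic_int_def le_max_iff_disj)
  next
    case False
    let ?k = "min (val2 x) (val2 y)"
    have "2 ^ ?k dvd x" "2 ^ ?k dvd y"
      using False val2_props(1) by (meson power_le_dvd min.cobounded1 min.cobounded2)+
    then have "?k \<le> val2 (x + y)"
      using False by (intro val2_props(2)) auto
    then have "(1 / 2 :: real) ^ val2 (x + y) \<le> (1 / 2) ^ ?k"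
      by (intro power_decreasing) auto
    also have "\<dots> \<le> max ((1 / 2) ^ val2 x) ((1 / 2) ^ val2 y)"
      by (auto simp: min_def)
    finally show ?thesis
      using False by (simp add: absval_two_adic_int_def)
  qed
qed

end

lift_definition fract_absval :: "'a :: valued_idom fract \<Rightarrow> real"
  is "\<lambda>(a, b). absval a / absval b"
  by (auto simp: frac_eq_eq simp flip: absval_mult)

lemma fract_absval_Fract: "fract_absval (Fraction_Field.Fract a b) = absval a / absval b"
  by transfer auto

lemma fract_absval_eq_0_iff [simp]: "fract_absval q = 0 \<longleftrightarrow> q = 0"
  by (cases q) (auto simp: fract_absval_Fract Zero_fract_def eq_fract)

lemma fract_absval_minus [simp]: "fract_absval (- q) = fract_absval q"
  by (cases q) (simp add: fract_absval_Fract)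

lemma fract_absval_nonneg: "0 \<le> fract_absval q"
  by (cases q) (simp add: fract_absval_Fract absval_nonneg)

lemma fract_absval_add_le: "fract_absval (q + r) \<le> fract_absval q + fract_absval r"
proof (cases q; cases r)
  fix a b c d :: 'a
  assume *: "q = Fraction_Field.Fract a b" "b \<noteq> 0" "r = Fraction_Field.Fract c d" "d \<noteq> 0"
  have pos: "0 < absval b" "0 < absval d"
    using * absval_nonneg by (simp_all add: less_le)
  have "absval (a * d + c * b) \<le> absval a * absval d + absval c * absval b"
    using absval_add_le_max[of "a * d" "c * b"] absval_nonneg[of "a * d"] absval_nonneg[of "c * b"]
    by (simp add: absval_mult)
  then show ?thesis
    using * pos by (simp add: fract_absval_Fract absval_mult add_frac_eq divide_right_mono)
qed

instantiation fract :: (valued_idom) metric_space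
begin

definition dist_fract :: "'a fract \<Rightarrow> 'a fract \<Rightarrow> real" where
  "dist_fract q r = fract_absval (q - r)"

definition uniformity_fract :: "('a fract \<times> 'a fract) filter" where
  "uniformity_fract = (INF e\<in>{0 <..}. principal {(q, r). dist q r < e})"

definition open_fract :: "'a fract set \<Rightarrow> bool" where
  "open_fract U \<longleftrightarrow> (\<forall>q\<in>U. eventually (\<lambda>(q', r). q' = q \<longrightarrow> r \<in> U) uniformity)"

instance
proof
  fix q r s :: "'a fract"
  show "dist q r = 0 \<longleftrightarrow> q = r"
    by (simp add: dist_fract_def)
  show "dist q r \<le> dist q s + dist r s"
    using fract_absval_add_le[of "q - s" "- (r - s)"]
    by (simp add: dist_fract_def del: minus_diff_eq)
qed (simp_all add: uniformity_fract_def open_fract_def)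

end

type_synonym two_adic = "two_adic_int fract"

definition to_two_adic :: "two_adic_int \<Rightarrow> two_adic" where
  "to_two_adic x = Fraction_Field.Fract x 1"


section \<open>Exponential, logarithm and powers\<close>

text \<open>
  Infinite sums are taken in the 2-adic metric. Below, the logarithm is only applied to principal
  units \<open>u\<close> in \<open>1 + 4\<int>\<^sub>2\<close> and the exponential to arguments in \<open>4\<int>\<^sub>2\<close>, where the series converge.
\<close>

definition exp_2adic :: "two_adic \<Rightarrow> two_adic" where
  "exp_2adic t = (\<Sum>k. t ^ k / of_nat (fact k))"

definition log_2adic :: "two_adic \<Rightarrow> two_adic" where
  "log_2adic u = (\<Sum>k. (- 1) ^ k * (u - 1) ^ Suc k / of_nat (Suc k))"

text \<open>
  For a unit \<open>x\<close>, that is, \<open>\<not> 2 dvd x\<close>: \<open>teich x\<close> is the sign congruent to \<open>x\<close> modulo 4 (usually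
  written \<open>\<omega>(x)\<close>), \<open>princ x\<close> is the principal unit \<open>\<langle>x\<rangle> = x / \<omega>(x)\<close>, and \<open>princ_pow x z\<close> is
  \<open>\<langle>x\<rangle>\<close> to the 2-adic exponent \<open>z\<close>. Elsewhere the values are unspecified.
\<close>

definition teich :: "two_adic_int \<Rightarrow> two_adic_int" where
  "teich x = (THE w. w \<in> {1, - 1} \<and> 4 dvd w - x)"

lemma ex1_teich:
  assumes "\<not> 2 dvd x"
  shows "\<exists>!w. w \<in> {1, - 1} \<and> 4 dvd w - (x :: two_adic_int)"
proof -
  have four: "4 dvd y \<longleftrightarrow> residue y 2 = 0" for y
    using two_power_dvd_iff[of 2 y] by simp
  have res: "residue (x + 1) 2 = (residue x 2 + 1) mod 4" "residue (x - 1) 2 = (residue x 2 - 1) mod 4"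
    using residue_add[of "x - 1" 1 2] residue_bounds[of "x - 1" 2]
    by (simp_all add: residue_add residue_1) presburger
  have "residue x 2 mod 2 \<noteq> 0"
    using assms two_power_dvd_iff[of 1 x] residue_le_mod[of 1 2 x] by simp
  then have "residue x 2 = 1 \<or> residue x 2 = 3"
    using residue_bounds[of x 2] by simp presburger
  then have "(4 dvd x - 1) \<noteq> (4 dvd x + 1)"
    by (auto simp: four res)
  moreover have "4 dvd 1 - x \<longleftrightarrow> 4 dvd x - 1" "4 dvd - 1 - x \<longleftrightarrow> 4 dvd x + 1"
    using dvd_minus_iff[of 4 "x - 1"] dvd_minus_iff[of 4 "x + 1"] by (simp_all add: algebra_simps)
  ultimately show ?thesis by auto
qed

definition princ :: "two_adic_int \<Rightarrow> two_adic" where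
  "princ x = to_two_adic x / to_two_adic (teich x)"

definition princ_pow :: "two_adic_int \<Rightarrow> two_adic_int \<Rightarrow> two_adic" where
  "princ_pow x z = exp_2adic (to_two_adic z * log_2adic (princ x))"

end

theory Submission
  imports Defs
begin

text \<open>
  The counting part. Modulo \<open>2 ^ e\<close> the first congruence determines \<open>y\<close> from \<open>x\<close>, and
  substituting it into the second turns the pair of congruences into
  \<open>x ^ (x ^ (n * (1 + x ^ n))) \<equiv> x\<close>. Up to the unit \<open>x\<close> this says that
  \<open>2 ^ e\<close> divides \<open>x ^ N - 1\<close>, where \<open>N = x ^ M - 1\<close> and \<open>M = n * (1 + x ^ n)\<close>. Lifting the exponent
  (\<open>multiplicity_even_power_minus_1\<close>), applied to \<open>N\<close> and to \<open>M\<close>, shows that for \<open>x > 1\<close>, with \<open>v\<close>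
  the 2-adic valuation, this holds if and only if
  \<open>e \<le> 2 v(x - 1) + 2 v(x + 1) + v(n) + v(1 + x ^ n) - 2\<close> (\<open>power_tower_cong_iff\<close>). Since one of
  \<open>x - 1\<close>, \<open>x + 1\<close> has valuation 1, the solutions fill, for \<open>e \<ge> 2\<close>, one residue class around 1
  and one around \<open>-1\<close>. The two radii differ only if \<open>n\<close> is odd, because then \<open>1 + x ^ n\<close> is as divisible by 2
  as \<open>1 + x\<close>; hence the different counts for odd and even \<open>n\<close>.

  The 2-adic part. Taking logarithms, a solution satisfies \<open>log \<langle>y\<rangle> = x ^ n log \<langle>x\<rangle>\<close> and
  \<open>log \<langle>x\<rangle> = y ^ n log \<langle>y\<rangle>\<close>. If \<open>log \<langle>x\<rangle>\<close> is not zero, these force \<open>(x y) ^ n = 1\<close>, hence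
  \<open>log \<langle>x\<rangle> + log \<langle>y\<rangle> = 0\<close>, hence \<open>x ^ n = -1\<close>, hence \<open>log \<langle>x\<rangle> = 0\<close> after all
  (\<open>two_adic_solutions\<close>). What is needed about the series is that on \<open>1 + 4\<int>\<^sub>2\<close> the logarithm
  is additive, vanishes only at 1 and inverts the exponential. All of this follows from
  \<open>log u = lim (u ^ (2 ^ m) - 1) / 2 ^ m\<close> with an explicit error (\<open>log_2adic_approx\<close>), from the
  addition formula of the exponential, and from ultrametric estimates of the tails.
\<close>

section \<open>Valuations of powers minus one\<close>

lemma multiplicity_int: "multiplicity (int p) (int k) = multiplicity p k"
proof -
  have "int p ^ m dvd int k \<longleftrightarrow> p ^ m dvd k" for m
    by (metis of_nat_dvd_iff of_nat_power)
  then show ?thesis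
    by (simp add: multiplicity_def)
qed

lemma prime_elem_two_int: "prime_elem (2 :: int)"
  by (simp add: prime_int_numeral_eq)

lemma even_sum_powers_iff:
  fixes x :: int
  assumes "odd x"
  shows "even (\<Sum>i<d. x ^ i) \<longleftrightarrow> even d"
  using assms by (induction d) auto

text \<open>
  The cofactor \<open>1 + x + \<dots> + x ^ (d - 1)\<close> is a sum of an odd number of odd terms, so it does not
  contribute to the valuation.
\<close>

lemma multiplicity_odd_power_minus_1:
  fixes x :: int
  assumes "odd x" "odd d"
  shows "multiplicity 2 (x ^ d - 1) = multiplicity 2 (x - 1)"
proof -
  have "multiplicity 2 ((\<Sum>i<d. x ^ i) * (x - 1)) = multiplicity 2 (x - 1)"
    using assms even_sum_powers_iff[of x d]
    by (intro multiplicity_prime_elem_times_other prime_elem_two_int) auto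
  then show ?thesis by (simp add: power_diff_1_eq mult.commute)
qed

lemma multiplicity_minus: "multiplicity p (- x :: int) = multiplicity p x"
  unfolding multiplicity_def by simp

lemma multiplicity_odd_power_plus_1:
  fixes x :: int
  assumes "odd x" "odd d"
  shows "multiplicity 2 (x ^ d + 1) = multiplicity 2 (x + 1)"
proof -
  have "multiplicity 2 ((- x) ^ d - 1) = multiplicity 2 (- x - 1)"
    using assms by (intro multiplicity_odd_power_minus_1) auto
  moreover have "(- x) ^ d - 1 = - (x ^ d + 1)" "- x - 1 = - (x + 1)"
    using assms by simp_all
  ultimately show ?thesis
    by (simp only: multiplicity_minus)
qed

lemma multiplicity_2_eq_1:
  fixes z :: int
  assumes "[z = 2] (mod 4)"
  shows "multiplicity 2 z = 1"
proof (rule multiplicity_eqI)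
  have "z mod 4 = 2" using assms by (simp add: cong_def)
  then show "2 ^ 1 dvd z" "\<not> 2 ^ Suc 1 dvd z" by (simp_all; presburger)+
qed

lemma odd_power_even_cong_1:
  fixes x :: int
  assumes "odd x" "even d"
  shows "[x ^ d = 1] (mod 4)"
proof -
  have "x mod 4 = 1 \<or> x mod 4 = 3" using assms(1) by presburger
  then have "[x = 1] (mod 4) \<or> [x = - 1] (mod 4)" by (auto simp: cong_def)
  then have "[x ^ d = 1 ^ d] (mod 4) \<or> [x ^ d = (- 1) ^ d] (mod 4)" using cong_pow by blast
  then show ?thesis using assms(2) by simp
qed

lemma multiplicity_even_power_plus_1:
  fixes x :: int
  assumes "odd x" "even d"
  shows "multiplicity 2 (x ^ d + 1) = 1"
  using cong_add[OF odd_power_even_cong_1[OF assms] cong_refl[of 1 4]]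
  by (intro multiplicity_2_eq_1) simp

text \<open>
  The case \<open>p = 2\<close> of ``lifting the exponent''. The odd part of \<open>m\<close> contributes nothing, and each
  squaring after the first multiplies \<open>z - 1\<close> by \<open>z + 1\<close> for a square \<open>z \<equiv> 1 (mod 4)\<close>, which
  raises the valuation by exactly one. The first squaring is different, because \<open>x + 1\<close> may be
  divisible by a high power of 2; this is why \<open>x\<^sup>2 - 1\<close> appears in place of \<open>x - 1\<close>.
\<close>

lemma multiplicity_even_power_minus_1:
  fixes x :: int
  assumes "odd x" "x\<^sup>2 \<noteq> 1" "even m" "m > 0"
  shows "multiplicity 2 (x ^ m - 1) + 1 = multiplicity 2 (x\<^sup>2 - 1) + multiplicity 2 m"
proof -
  obtain d where d: "m = 2 ^ multiplicity 2 m * d" "odd d"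
    using multiplicity_decompose'[of m 2] assms(4) by auto
  have "multiplicity 2 m \<noteq> 0" using d assms(3) by (metis even_mult_iff power_0 odd_one)
  then obtain j where j: "multiplicity 2 m = Suc j" using not0_implies_Suc by blast
  have nz: "x ^ (2 ^ Suc i) \<noteq> 1" for i
  proof
    assume "x ^ (2 ^ Suc i) = 1"
    then have "\<bar>x\<bar> ^ (2 ^ Suc i) = 1" by (simp flip: power_abs del: power_Suc)
    moreover have "\<bar>x\<bar> \<noteq> 1" using assms(2) by (simp add: abs_square_eq_1)
    then have "\<bar>x\<bar> > 1" using assms(1) by (cases "x = 0") auto
    then have "\<bar>x\<bar> ^ (2 ^ Suc i) > 1" by (intro one_less_power) auto
    ultimately show False by simp
  qed
  have pow: "multiplicity 2 (x ^ (2 ^ Suc i) - 1) = multiplicity 2 (x\<^sup>2 - 1) + i" for i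
  proof (induction i)
    case (Suc i)
    let ?z = "x ^ (2 ^ Suc i)"
    have "x ^ (2 ^ Suc (Suc i)) = ?z ^ 2"
      by (metis power_Suc power_mult mult.commute)
    then have fac: "x ^ (2 ^ Suc (Suc i)) - 1 = (?z - 1) * (?z + 1)"
      by (simp add: power2_eq_square algebra_simps)
    have one: "multiplicity 2 (?z + 1) = 1"
      using assms(1) by (intro multiplicity_even_power_plus_1) auto
    then have "?z + 1 \<noteq> 0" by force
    then show ?case
      unfolding fac using nz[of i] one Suc
      by (subst prime_elem_multiplicity_mult_distrib[OF prime_elem_two_int]) auto
  qed simp
  have "x ^ m = (x ^ (2 ^ Suc j)) ^ d" by (metis d(1) j power_mult)
  then have "multiplicity 2 (x ^ m - 1) = multiplicity 2 (x ^ (2 ^ Suc j) - 1)"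
    using multiplicity_odd_power_minus_1[of "x ^ (2 ^ Suc j)" d] assms(1) d(2) by simp
  then show ?thesis using pow[of j] j by simp
qed


section \<open>Counting the solutions modulo powers of 2\<close>

lemma odd_power_two_power_cong_1:
  fixes y :: nat
  assumes "odd y"
  shows "[y ^ (2 ^ e) = 1] (mod 2 ^ e)"
proof -
  have "[int y ^ (2 ^ e) = 1] (mod 2 ^ e)"
  proof (induction e)
    case (Suc e)
    let ?z = "int y ^ 2 ^ e"
    have "int y ^ 2 ^ Suc e = ?z ^ 2"
      by (metis power_Suc power_mult mult.commute)
    then have "int y ^ 2 ^ Suc e - 1 = (?z + 1) * (?z - 1)"
      by (simp add: power2_eq_square algebra_simps)
    moreover have "2 * 2 ^ e dvd (?z + 1) * (?z - 1)"
      using Suc assms by (intro mult_dvd_mono) (auto simp: cong_iff_dvd_diff)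
    ultimately show ?case by (simp add: cong_iff_dvd_diff)
  qed simp
  then show ?thesis by (metis cong_int_iff of_nat_1 of_nat_numeral of_nat_power)
qed

text \<open>
  The exponent of the group of units modulo \<open>2 ^ e\<close> divides \<open>2 ^ e\<close>, so the same modulus serves
  for the base and for the exponent. This makes \<open>x \<mapsto> x ^ (x ^ n)\<close> a well-defined self-map of the
  units modulo \<open>2 ^ e\<close>.
\<close>

lemma odd_power_cong_exponent:
  fixes y a b :: nat
  assumes "odd y" "[a = b] (mod 2 ^ e)"
  shows "[y ^ a = y ^ b] (mod 2 ^ e)"
proof -
  have "[y ^ c = y ^ (c mod 2 ^ e)] (mod 2 ^ e)" for c
  proof -
    have "y ^ c = (y ^ (2 ^ e)) ^ (c div 2 ^ e) * y ^ (c mod 2 ^ e)"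
      by (simp flip: power_mult power_add)
    moreover have "[(y ^ (2 ^ e)) ^ (c div 2 ^ e) * y ^ (c mod 2 ^ e) = 1 ^ (c div 2 ^ e) * y ^ (c mod 2 ^ e)] (mod 2 ^ e)"
      by (intro cong_mult cong_pow odd_power_two_power_cong_1 assms(1) cong_refl)
    ultimately show ?thesis by simp
  qed
  from this[of a] this[of b] show ?thesis
    using assms(2) unfolding cong_def by metis
qed

text \<open>
  The first congruence determines \<open>y\<close>, so the pairs correspond to the fixed points of the second
  iterate of \<open>x \<mapsto> x ^ (x ^ n)\<close>, which is again a power tower in \<open>x\<close>: with \<open>y = x ^ (x ^ n)\<close> one
  has \<open>y ^ n = x ^ (n * x ^ n)\<close> and hence
  \<open>y ^ (y ^ n) = x ^ (x ^ n * x ^ (n * x ^ n))\<close>.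
\<close>

lemma num_solutions_eq_card_fixpoints:
  assumes "e \<ge> 1"
  shows "num_solutions n e =
    card {x \<in> {1..2 ^ e}. odd x \<and> [x ^ (x ^ (n * (1 + x ^ n))) = x] (mod 2 ^ e)}"
    (is "_ = card ?T")
proof -
  have iter: "[y ^ (y ^ n) = x ^ (x ^ (n * (1 + x ^ n)))] (mod 2 ^ e)"
    if "odd x" "odd y" "[x ^ (x ^ n) = y] (mod 2 ^ e)" for x y :: nat
  proof -
    have "[y ^ (y ^ n) = y ^ ((x ^ (x ^ n)) ^ n)] (mod 2 ^ e)"
      using that by (intro odd_power_cong_exponent cong_pow) (simp_all add: cong_sym)
    also have "[y ^ ((x ^ (x ^ n)) ^ n) = (x ^ (x ^ n)) ^ ((x ^ (x ^ n)) ^ n)] (mod 2 ^ e)"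
      using that by (intro cong_pow) (simp add: cong_sym)
    also have "(x ^ (x ^ n)) ^ ((x ^ (x ^ n)) ^ n) = x ^ (x ^ (n * (1 + x ^ n)))"
      by (simp add: algebra_simps flip: power_mult power_add)
    finally show ?thesis .
  qed
  have oddmod: "odd (a mod 2 ^ e) \<longleftrightarrow> odd a" for a :: nat
    using assms by (simp add: dvd_mod_iff)
  have modeq: "y = z mod 2 ^ e" if "[z = y] (mod 2 ^ e)" "odd y" "y \<le> 2 ^ e" for y z :: nat
  proof -
    have "y \<noteq> 2 ^ e" using that(2) assms by auto
    then show ?thesis using that by (simp add: cong_def)
  qed
  have "{(x, y). x \<in> {1..2 ^ e} \<and> y \<in> {1..2 ^ e} \<and> odd x \<and> odd y \<and>
      [x ^ (x ^ n) = y] (mod 2 ^ e) \<and> [y ^ (y ^ n) = x] (mod 2 ^ e)} =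
    (\<lambda>x. (x, x ^ (x ^ n) mod 2 ^ e)) ` ?T" (is "?S = ?f ` _")
  proof (intro equalityI subsetI)
    fix p assume "p \<in> ?S"
    then obtain x y where p: "p = (x, y)" and xy: "x \<in> {1..2 ^ e}" "y \<in> {1..2 ^ e}" "odd x" "odd y"
      "[x ^ (x ^ n) = y] (mod 2 ^ e)" "[y ^ (y ^ n) = x] (mod 2 ^ e)"
      by auto
    have "[x ^ (x ^ (n * (1 + x ^ n))) = x] (mod 2 ^ e)"
      using iter[OF xy(3-5)] xy(6) by (metis cong_sym cong_trans)
    then have "x \<in> ?T" using xy by blast
    moreover have "p = ?f x" using xy modeq[of "x ^ (x ^ n)" y] by (simp add: p)
    ultimately show "p \<in> ?f ` ?T" by blast
  next
    fix p assume "p \<in> ?f ` ?T"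
    then obtain x where x: "x \<in> ?T" and p: "p = ?f x" by blast
    let ?y = "x ^ (x ^ n) mod 2 ^ e"
    have "odd ?y" using x by (subst oddmod) simp
    moreover have "?y \<le> 2 ^ e" by (simp add: less_imp_le)
    moreover have "[x ^ (x ^ n) = ?y] (mod 2 ^ e)" by (simp add: cong_def)
    moreover have "[?y ^ (?y ^ n) = x] (mod 2 ^ e)"
      using x iter[of x ?y] calculation by (metis (mono_tags, lifting) cong_trans mem_Collect_eq)
    ultimately show "p \<in> ?S"
      using x by (auto simp: p intro!: Suc_leI odd_pos)
  qed
  moreover have "inj_on ?f ?T" by (auto intro: inj_onI)
  ultimately show ?thesis
    by (simp add: num_solutions_def card_image)
qed

text \<open>
  Cancelling one factor \<open>x\<close> turns the congruence into \<open>2 ^ e dvd x ^ N - 1\<close> with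
  \<open>N = x ^ M - 1\<close> and \<open>M = n * (1 + x ^ n)\<close>. Both \<open>N\<close> and \<open>M\<close> are even, so lifting the exponent
  applies twice and each application contributes the valuation of \<open>x\<^sup>2 - 1\<close>. The value \<open>x = 1\<close> is
  excluded because then \<open>x ^ N - 1 = 0\<close>, whose multiplicity carries no information.
\<close>

lemma power_tower_cong_iff:
  fixes x :: nat
  assumes "odd x" "x > 1" "n > 0"
  shows "[x ^ (x ^ (n * (1 + x ^ n))) = x] (mod 2 ^ e) \<longleftrightarrow>
    e + 2 \<le> 2 * multiplicity 2 (int x - 1) + 2 * multiplicity 2 (int x + 1)
      + multiplicity 2 n + multiplicity 2 (int x ^ n + 1)"
proof -
  let ?v = "multiplicity (2 :: int)" and ?X = "int x"
  define M where "M = n * (1 + x ^ n)"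
  define N where "N = x ^ M - 1"
  have M: "even M" "M > 0" using assms by (auto simp: M_def)
  have intN: "int N = ?X ^ M - 1" unfolding N_def using assms by (simp add: of_nat_diff)
  have "x ^ M > 1" using assms M by (intro one_less_power) auto
  then have N: "even N" "N > 0" using assms by (auto simp: N_def)
  have sq: "?X\<^sup>2 \<noteq> 1" using assms by (auto simp: abs_square_eq_1)
  have vsq: "?v (?X\<^sup>2 - 1) = ?v (?X - 1) + ?v (?X + 1)"
  proof -
    have "?X\<^sup>2 - 1 = (?X - 1) * (?X + 1)" by (simp add: power2_eq_square algebra_simps)
    then show ?thesis
      using assms by (simp add: prime_elem_multiplicity_mult_distrib[OF prime_elem_two_int])
  qed
  have vM: "multiplicity 2 M = multiplicity 2 n + ?v (?X ^ n + 1)"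
  proof -
    have "int M = int n * (?X ^ n + 1)" by (simp add: M_def algebra_simps)
    moreover have "?X ^ n + 1 \<noteq> 0" using zero_le_power[of ?X n] by linarith
    ultimately have "?v (int M) = ?v (int n) + ?v (?X ^ n + 1)"
      using assms by (simp add: prime_elem_multiplicity_mult_distrib[OF prime_elem_two_int])
    then show ?thesis
      using multiplicity_int[of 2] by simp
  qed
  have vN: "multiplicity 2 N + 1 = ?v (?X\<^sup>2 - 1) + multiplicity 2 M"
    using multiplicity_even_power_minus_1[OF _ sq M] assms(1) multiplicity_int[of 2 N]
    by (simp add: intN)
  have vXN: "?v (?X ^ N - 1) + 1 = ?v (?X\<^sup>2 - 1) + multiplicity 2 N"
    using multiplicity_even_power_minus_1[OF _ sq N] assms(1) by simp
  have XN: "?X ^ N - 1 \<noteq> 0"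
  proof -
    have "?X ^ N > 1" using assms N by (intro one_less_power) auto
    then show ?thesis by simp
  qed
  have "x ^ (x ^ M) = x * x ^ N"
  proof -
    have "x ^ M = Suc N" using \<open>x ^ M > 1\<close> by (simp add: N_def)
    then show ?thesis by simp
  qed
  then have "[x ^ (x ^ M) = x] (mod 2 ^ e) \<longleftrightarrow> [?X * ?X ^ N = ?X * 1] (mod 2 ^ e)"
    by (simp flip: cong_int_iff)
  also have "\<dots> \<longleftrightarrow> [?X ^ N = 1] (mod 2 ^ e)"
    using assms(1) by (intro cong_mult_lcancel) simp
  also have "\<dots> \<longleftrightarrow> e \<le> ?v (?X ^ N - 1)"
    using XN by (simp add: cong_iff_dvd_diff power_dvd_iff_le_multiplicity)
  also have "\<dots> \<longleftrightarrow> e + 2 \<le> 2 * ?v (?X - 1) + 2 * ?v (?X + 1) + multiplicity 2 n + ?v (?X ^ n + 1)"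
    using vM vN vXN vsq by linarith
  finally show ?thesis by (simp add: M_def)
qed

lemma card_cong_1:
  assumes "a \<le> e"
  shows "card {x \<in> {1..2 ^ e :: nat}. 2 ^ a dvd int x - 1} = 2 ^ (e - a)"
proof -
  have e: "(2::nat) ^ e = 2 ^ a * 2 ^ (e - a)" using assms by (simp flip: power_add)
  have "{x \<in> {1..2 ^ e :: nat}. 2 ^ a dvd int x - 1} = (\<lambda>t. 1 + 2 ^ a * t) ` {..<2 ^ (e - a)}"
  proof (intro equalityI subsetI)
    fix x assume x: "x \<in> {x \<in> {1..2 ^ e :: nat}. 2 ^ a dvd int x - 1}"
    then have "int (2 ^ a) dvd int (x - 1)" by (simp add: of_nat_diff)
    then obtain t where t: "x - 1 = 2 ^ a * t" unfolding of_nat_dvd_iff by (rule dvdE)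
    have "x - 1 < 2 ^ e" using x by auto
    then have "2 ^ a * t < 2 ^ a * 2 ^ (e - a)" by (simp only: t e)
    then have "t < 2 ^ (e - a)" by simp
    then show "x \<in> (\<lambda>t. 1 + 2 ^ a * t) ` {..<2 ^ (e - a)}" using t x by force
  next
    fix x assume "x \<in> (\<lambda>t. 1 + 2 ^ a * t) ` {..<2 ^ (e - a) :: nat}"
    then obtain t where t: "t < 2 ^ (e - a)" "x = 1 + 2 ^ a * t" by auto
    have "2 ^ a * t < 2 ^ e" using t e by simp
    then have "x \<le> 2 ^ e" using t(2) by linarith
    then show "x \<in> {x \<in> {1..2 ^ e :: nat}. 2 ^ a dvd int x - 1}" using t by simp
  qed
  then show ?thesis by (simp add: card_image inj_on_def)
qed

lemma card_cong_minus_1: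
  assumes "a \<le> e"
  shows "card {x \<in> {1..2 ^ e :: nat}. 2 ^ a dvd int x + 1} = 2 ^ (e - a)"
proof (cases "a = 0")
  case False
  \<comment> \<open>The least positive residue of \<open>-1\<close>.\<close>
  define r :: nat where "r = 2 ^ a - 1"
  have "(2 :: nat) ^ 1 \<le> 2 ^ a" using False by (intro power_increasing) auto
  then have r: "2 ^ a = r + 1" "r \<ge> 1" by (auto simp: r_def)
  have "{x \<in> {1..2 ^ e :: nat}. 2 ^ a dvd int x + 1} = (\<lambda>t. r + 2 ^ a * t) ` {..<2 ^ (e - a)}"
  proof (intro equalityI subsetI)
    fix x assume x: "x \<in> {x \<in> {1..2 ^ e :: nat}. 2 ^ a dvd int x + 1}"
    then have "int (2 ^ a) dvd int (x + 1)" by (simp add: add.commute)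
    then obtain s where s: "x + 1 = 2 ^ a * s" unfolding of_nat_dvd_iff by (rule dvdE)
    then obtain t where t: "s = Suc t" by (cases s) auto
    have "x = r + 2 ^ a * t" using s t r by simp
    moreover have "2 ^ a * t < 2 ^ a * 2 ^ (e - a)"
      using x calculation r(2) assms by (simp flip: power_add)
    then have "t < 2 ^ (e - a)" by simp
    ultimately show "x \<in> (\<lambda>t. r + 2 ^ a * t) ` {..<2 ^ (e - a)}" by blast
  next
    fix x assume "x \<in> (\<lambda>t. r + 2 ^ a * t) ` {..<2 ^ (e - a) :: nat}"
    then obtain t where t: "t < 2 ^ (e - a)" "x = r + 2 ^ a * t" by auto
    have x: "x + 1 = 2 ^ a * (t + 1)" using t r by simp
    have "2 ^ a * (t + 1) \<le> 2 ^ a * 2 ^ (e - a)" using t(1) by (intro mult_left_mono) auto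
    then have "x \<le> 2 ^ e" using x assms by (simp flip: power_add)
    moreover have "2 ^ a dvd int x + 1"
    proof -
      have "int x + 1 = int (x + 1)" by simp
      also have "\<dots> = 2 ^ a * int (t + 1)" unfolding x by (simp only: of_nat_mult of_nat_power of_nat_numeral)
      finally show ?thesis by simp
    qed
    ultimately show "x \<in> {x \<in> {1..2 ^ e :: nat}. 2 ^ a dvd int x + 1}" using t r by simp
  qed
  then show ?thesis by (simp add: card_image inj_on_def)
next
  case True
  then have "{x \<in> {1..2 ^ e :: nat}. 2 ^ a dvd int x + 1} = {1..2 ^ e}" by auto
  then show ?thesis using True by (simp only: card_atLeastAtMost) simp
qed

text \<open>
  Of \<open>x - 1\<close> and \<open>x + 1\<close> one has valuation 1, and this splits the fixed points into two residue
  classes. If \<open>x \<equiv> 1 (mod 4)\<close>, then \<open>1 + x ^ n\<close> also has valuation 1, and the condition on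
  \<open>k = v(x - 1)\<close> is \<open>e \<le> 2 * k + v(n) + 1\<close>. If \<open>x \<equiv> -1 (mod 4)\<close> and \<open>k = v(x + 1)\<close>, it is the same
  condition for even \<open>n\<close>, whereas for odd \<open>n\<close> the factor \<open>1 + x ^ n\<close> has valuation \<open>k\<close> as well, and
  the condition becomes \<open>e \<le> 3 * k\<close>. The maximum with 2 encodes the residue modulo 4.
\<close>

lemma num_solutions_closed_form:
  assumes "n > 0" "e \<ge> 2"
  defines "v \<equiv> multiplicity 2 n"
  defines "a \<equiv> max 2 ((e - v) div 2)"
  defines "b \<equiv> (if even n then a else max 2 ((e + 2) div 3))"
  shows "num_solutions n e = 2 ^ (e - a) + 2 ^ (e - b)"
proof -
  let ?v = "multiplicity (2 :: int)"
  let ?A = "{x \<in> {1..2 ^ e :: nat}. 2 ^ a dvd int x - 1}"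
  let ?B = "{x \<in> {1..2 ^ e :: nat}. 2 ^ b dvd int x + 1}"
  let ?P = "\<lambda>x. [x ^ (x ^ (n * (1 + x ^ n))) = x] (mod 2 ^ e)"
  have ab: "a \<le> e" "b \<le> e" "a \<ge> 2" "b \<ge> 2" using assms(2) by (auto simp: a_def b_def)
  have four: "(4::int) dvd z" if "2 ^ k dvd z" "k \<ge> 2" for k z
    using that power_le_dvd[of 2 k z 2] by simp
  have odd_n: "v = 0" if "odd n" unfolding v_def using that by (simp add: not_dvd_imp_multiplicity_0)
  \<comment> \<open>For \<open>x = 1\<close> the congruence and the divisibility of \<open>x - 1\<close> are both trivially true.\<close>
  have "odd x \<and> ?P x \<longleftrightarrow> 2 ^ a dvd int x - 1 \<or> 2 ^ b dvd int x + 1" if "x \<ge> 1" for x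
  proof (cases "x = 1")
    case False
    then have x: "x > 1" using that by simp
    have "x mod 4 = 1 \<or> x mod 4 = 3 \<or> even x" by presburger
    then consider "even x" | "x mod 4 = 1" | "x mod 4 = 3" by blast
    then show ?thesis
    proof cases
      case 1
      then have "\<not> 4 dvd int x - 1" "\<not> 4 dvd int x + 1" by presburger+
      then show ?thesis using 1 four ab by blast
    next
      case 2
      then have o: "odd x" by presburger
      have "[int x + 1 = 2] (mod 4)" using 2 unfolding cong_def by presburger
      then have "?v (int x + 1) = 1" by (rule multiplicity_2_eq_1)
      moreover from this have "?v (int x ^ n + 1) = 1"
        using multiplicity_odd_power_plus_1[of "int x" n] multiplicity_even_power_plus_1[of "int x" n] o
        by (cases "even n") auto
      ultimately have "?P x \<longleftrightarrow> (e - v) div 2 \<le> ?v (int x - 1)"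
        using power_tower_cong_iff[OF o x assms(1), of e] by (simp add: v_def) linarith
      also have "\<dots> \<longleftrightarrow> a \<le> ?v (int x - 1)"
      proof -
        have "2 ^ 2 dvd int x - 1" using 2 by simp presburger
        then have "2 \<le> ?v (int x - 1)" using x by (intro multiplicity_geI) auto
        then show ?thesis by (simp add: a_def)
      qed
      also have "\<dots> \<longleftrightarrow> 2 ^ a dvd int x - 1"
        using x by (simp add: power_dvd_iff_le_multiplicity)
      moreover have "\<not> 2 ^ b dvd int x + 1"
      proof
        assume "2 ^ b dvd int x + 1"
        then have "4 dvd int x + 1" using four ab by blast
        then show False using 2 by presburger
      qed
      ultimately show ?thesis using o by simp
    next
      case 3
      then have o: "odd x" by presburger
      have "[int x - 1 = 2] (mod 4)" using 3 unfolding cong_def by presburger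
      then have "?v (int x - 1) = 1" by (rule multiplicity_2_eq_1)
      moreover have "?v (int x ^ n + 1) = (if even n then 1 else ?v (int x + 1))"
        using multiplicity_odd_power_plus_1[of "int x" n] multiplicity_even_power_plus_1[of "int x" n] o
        by (cases "even n") auto
      ultimately have "?P x \<longleftrightarrow>
          (if even n then (e - v) div 2 else (e + 2) div 3) \<le> ?v (int x + 1)"
        using power_tower_cong_iff[OF o x assms(1), of e] odd_n
        by (cases "even n") (simp_all add: v_def, linarith+)
      also have "\<dots> \<longleftrightarrow> b \<le> ?v (int x + 1)"
      proof -
        have "2 ^ 2 dvd int x + 1" using 3 by simp presburger
        then have "2 \<le> ?v (int x + 1)" using x by (intro multiplicity_geI) auto
        then show ?thesis by (simp add: a_def b_def)
      qed
      also have "\<dots> \<longleftrightarrow> 2 ^ b dvd int x + 1"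
        using x by (simp add: power_dvd_iff_le_multiplicity)
      moreover have "\<not> 2 ^ a dvd int x - 1"
      proof
        assume "2 ^ a dvd int x - 1"
        then have "4 dvd int x - 1" using four ab by blast
        then show False using 3 by presburger
      qed
      ultimately show ?thesis using o by simp
    qed
  qed simp
  then have "{x \<in> {1..2 ^ e}. odd x \<and> ?P x} = ?A \<union> ?B"
    by auto
  then have "num_solutions n e = card (?A \<union> ?B)"
    using assms(2) by (simp only: num_solutions_eq_card_fixpoints)
  moreover have "?A \<inter> ?B = {}"
  proof -
    have False if "2 ^ a dvd int x - 1" "2 ^ b dvd int x + 1" for x
    proof -
      have "4 dvd int x - 1" "4 dvd int x + 1" using that four ab by blast+
      then show False by presburger
    qed
    then show ?thesis by blast
  qed
  then have "card (?A \<union> ?B) = card ?A + card ?B"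
    by (intro card_Un_disjoint) auto
  ultimately show ?thesis
    using ab by (simp only: card_cong_1 card_cong_minus_1)
qed

lemma num_solutions_1: "num_solutions n 1 = 1"
proof -
  have "x = 1" if "x \<in> {1..2 ^ 1}" "odd x" for x :: nat
    using that by simp presburger
  then have "{x \<in> {1..2 ^ 1}. odd x \<and> [x ^ (x ^ (n * (1 + x ^ n))) = x] (mod 2 ^ 1)} = {1 :: nat}"
    by auto
  then show ?thesis
    unfolding num_solutions_eq_card_fixpoints[OF order_refl] by (simp only: is_singletonI is_singleton_altdef[symmetric])
qed

lemma num_solutions_odd:
  assumes "odd n" "e \<ge> 1"
  shows "num_solutions n e =
    (if e = 1 then 1 else if e \<le> 4 then 2 * 2 ^ (e - 2)
     else 2 ^ ((e + 1) div 2) + 2 ^ (e div 3 + (e + 1) div 3))"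
proof (cases "e = 1")
  case True
  then show ?thesis by (simp add: num_solutions_1 del: One_nat_def)
next
  case False
  have v: "multiplicity 2 n = 0" using assms(1) by (simp add: not_dvd_imp_multiplicity_0)
  have n: "num_solutions n e = 2 ^ (e - max 2 (e div 2)) + 2 ^ (e - max 2 ((e + 2) div 3))"
    using num_solutions_closed_form[of n e] assms False by (simp add: v odd_pos)
  show ?thesis
  proof (cases "e \<le> 4")
    case True
    then have "max 2 (e div 2) = 2" "max 2 ((e + 2) div 3) = 2" by auto
    then show ?thesis using n False True by simp
  next
    case F: False
    then have "max 2 (e div 2) = e div 2" "max 2 ((e + 2) div 3) = (e + 2) div 3"
      by simp_all
    moreover have "e - e div 2 = (e + 1) div 2" by presburger
    moreover have "e - (e + 2) div 3 = e div 3 + (e + 1) div 3"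
    proof -
      have "e = 3 * (e div 3) \<or> e = 3 * (e div 3) + 1 \<or> e = 3 * (e div 3) + 2" by presburger
      then obtain q where "e = 3 * q \<or> e = 3 * q + 1 \<or> e = 3 * q + 2" by blast
      then show ?thesis
      proof (elim disjE)
        assume "e = 3 * q"
        moreover from this have "(e + 2) div 3 = q" "e div 3 = q" "(e + 1) div 3 = q" by presburger+
        ultimately show ?thesis by simp
      next
        assume "e = 3 * q + 1"
        moreover from this have "(e + 2) div 3 = q + 1" "e div 3 = q" "(e + 1) div 3 = q" by presburger+
        ultimately show ?thesis by simp
      qed simp
    qed
    ultimately have "e - max 2 (e div 2) = (e + 1) div 2"
      "e - max 2 ((e + 2) div 3) = e div 3 + (e + 1) div 3"
      by (simp_all only:)
    then show ?thesis using n False F by simp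
  qed
qed

lemma num_solutions_even:
  assumes "even n" "n > 0" "e \<ge> 1"
  shows "num_solutions n e =
    (if e = 1 then 1 else if e \<le> multiplicity 2 n + 4 then 2 * 2 ^ (e - 2)
     else 2 * 2 ^ ((e + multiplicity 2 n + 1) div 2))"
proof (cases "e = 1")
  case True
  then show ?thesis by (simp add: num_solutions_1 del: One_nat_def)
next
  case False
  define v where "v = multiplicity 2 n"
  have n: "num_solutions n e = 2 * 2 ^ (e - max 2 ((e - v) div 2))"
    using num_solutions_closed_form[of n e] assms False by (simp add: v_def)
  show ?thesis
  proof (cases "e \<le> v + 4")
    case True
    then have "max 2 ((e - v) div 2) = 2" by auto
    then show ?thesis using n False True by (simp add: v_def)
  next
    case F: False
    then obtain k where k: "e = v + 5 + k" using le_Suc_ex[of "v + 5" e] by auto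
    have "max 2 ((e - v) div 2) = (k + 5) div 2"
      unfolding k by simp
    moreover have "e - (k + 5) div 2 = (e + v + 1) div 2"
    proof -
      have "k = 2 * (k div 2) \<or> k = 2 * (k div 2) + 1" by presburger
      then obtain q where "k = 2 * q \<or> k = 2 * q + 1" by blast
      then show ?thesis unfolding k by (elim disjE) simp_all
    qed
    ultimately have "e - max 2 ((e - v) div 2) = (e + v + 1) div 2"
      by (simp only:)
    then show ?thesis using n False F by (simp add: v_def)
  qed
qed


section \<open>The ultrametric absolute value\<close>

lemma fract_absval_mult: "fract_absval (q * r) = fract_absval q * fract_absval r"
  by (cases q; cases r) (simp add: fract_absval_Fract absval_mult)

lemma fract_absval_1 [simp]: "fract_absval 1 = 1"
  by (simp add: One_fract_def fract_absval_Fract)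

lemma fract_absval_0 [simp]: "fract_absval 0 = 0"
  by simp

lemma fract_absval_power: "fract_absval (q ^ n) = fract_absval q ^ n"
  by (induction n) (simp_all add: fract_absval_mult)

lemma fract_absval_divide: "fract_absval (q / r) = fract_absval q / fract_absval r"
proof (cases "r = 0")
  case False
  then have "fract_absval (q / r) * fract_absval r = fract_absval q"
    by (simp flip: fract_absval_mult)
  then show ?thesis using False by (simp add: field_simps)
qed simp

lemma fract_absval_add_le_max: "fract_absval (q + r) \<le> max (fract_absval q) (fract_absval r)"
proof (cases q; cases r)
  fix a b c d :: 'a
  assume *: "q = Fraction_Field.Fract a b" "b \<noteq> 0" "r = Fraction_Field.Fract c d" "d \<noteq> 0"
  have pos: "0 < absval b" "0 < absval d"
    using * absval_nonneg by (simp_all add: less_le)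
  have "fract_absval (q + r) = absval (a * d + c * b) / (absval b * absval d)"
    using * by (simp add: fract_absval_Fract absval_mult)
  also have "\<dots> \<le> max (absval (a * d)) (absval (c * b)) / (absval b * absval d)"
    using pos by (intro divide_right_mono absval_add_le_max) simp
  also have "\<dots> = max (fract_absval q) (fract_absval r)"
    using * pos by (simp add: fract_absval_Fract absval_mult max_def field_simps)
  finally show ?thesis .
qed

lemma fract_absval_add_le_bound:
  "fract_absval q \<le> c \<Longrightarrow> fract_absval r \<le> c \<Longrightarrow> fract_absval (q + r) \<le> c"
  using fract_absval_add_le_max[of q r] by linarith

lemma fract_absval_diff_le_bound:
  "fract_absval q \<le> c \<Longrightarrow> fract_absval r \<le> c \<Longrightarrow> fract_absval (q - r) \<le> c"
  using fract_absval_add_le_bound[of q c "- r"] by simp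

lemma fract_absval_sum_le_bound:
  assumes "\<And>i. i \<in> A \<Longrightarrow> fract_absval (f i) \<le> c" "0 \<le> c"
  shows "fract_absval (sum f A) \<le> c"
  using assms by (induction A rule: infinite_finite_induct) (auto intro: fract_absval_add_le_bound)

lemma fract_absval_of_nat_le_1: "fract_absval (of_nat n) \<le> 1"
  by (induction n) (auto intro: fract_absval_add_le_bound)

text \<open>
  Identities between 2-adic limits are proved by this criterion: both sides are replaced by
  truncations, at the cost of an error of absolute value at most \<open>(1 / 2) ^ m\<close> for every \<open>m\<close>.
\<close>

lemma fract_eq_0_if_small:
  assumes "\<And>m. fract_absval q \<le> (1 / 2) ^ m"
  shows "q = 0"
proof (rule ccontr)
  assume "q \<noteq> 0"
  then have "fract_absval q > 0" using fract_absval_nonneg[of q] by (simp add: less_le)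
  then obtain m where "(1 / 2 :: real) ^ m < fract_absval q"
    using real_arch_pow_inv[of _ "1/2"] by auto
  then show False using assms[of m] by simp
qed


section \<open>Divisibility and completeness in the 2-adic integers\<close>

lemma absval_le_iff: "absval (x :: two_adic_int) \<le> (1 / 2) ^ k \<longleftrightarrow> 2 ^ k dvd x"
proof (cases "x = 0")
  case False
  have "2 ^ k dvd x \<longleftrightarrow> k \<le> val2 x"
    using val2_props[OF False] by (meson power_le_dvd)
  then show ?thesis using False by (simp add: absval_two_adic_int_def)
qed simp

lemma two_power_dvd_of_nat_iff: "2 ^ k dvd (of_nat m :: two_adic_int) \<longleftrightarrow> 2 ^ k dvd m"
proof -
  have "2 ^ k dvd (of_nat m :: two_adic_int) \<longleftrightarrow> int (m mod 2 ^ k) = 0"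
    by (simp add: two_power_dvd_iff residue_of_nat zmod_int)
  then show ?thesis by (simp add: dvd_eq_mod_eq_0)
qed

lemma two_power_dvd_diff_iff:
  "2 ^ k dvd x - y \<longleftrightarrow> residue x k = residue y k"
proof -
  have "residue (x - y) k = (residue x k - residue y k) mod 2 ^ k"
    by transfer simp
  then have "2 ^ k dvd x - y \<longleftrightarrow> residue x k mod 2 ^ k = residue y k mod 2 ^ k"
    by (simp add: two_power_dvd_iff mod_eq_dvd_iff dvd_eq_mod_eq_0 del: residue_mod)
  then show ?thesis by simp
qed

text \<open>
  Completeness of the 2-adic integers: in the inverse limit, the \<open>k\<close>-th residue of the limit can be
  read off from the \<open>k\<close>-th term.
\<close>

lemma two_adic_int_limit:
  assumes "\<And>k. 2 ^ k dvd X (Suc k) - X k"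
  obtains L :: two_adic_int where "\<And>k. 2 ^ k dvd L - X k"
proof -
  define L where "L = Abs_two_adic_int (\<lambda>k. residue (X k) k)"
  have "[residue (X (Suc k)) (Suc k) = residue (X k) k] (mod 2 ^ k)" for k
    using residue_Suc[of "X (Suc k)" k] assms[of k] by (simp add: two_power_dvd_diff_iff)
  then have "residue L k = residue (X k) k" for k
    unfolding L_def by (subst Abs_two_adic_int_inverse) (auto simp: residue_bounds)
  then show ?thesis using that[of L] by (simp add: two_power_dvd_diff_iff)
qed

text \<open>
  The inverse of \<open>c = 1 - (1 - c)\<close> is the sum of the geometric series in \<open>1 - c\<close>.
\<close>

lemma two_adic_int_inverse:
  fixes c :: two_adic_int
  assumes "2 dvd 1 - c"
  obtains d where "c * d = 1"
proof -
  define X where "X k = (\<Sum>i<k. (1 - c) ^ i)" for k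
  have pow: "2 ^ k dvd (1 - c) ^ k" for k using assms by (rule dvd_power_same)
  have "2 ^ k dvd X (Suc k) - X k" for k using pow[of k] by (simp add: X_def)
  then obtain L where L: "\<And>k. 2 ^ k dvd L - X k" using two_adic_int_limit[of X] by blast
  have "residue (c * L) k = residue 1 k" for k
  proof -
    have "c * X k = 1 - (1 - c) ^ k"
      using one_diff_power_eq[of "1 - c" k] by (simp add: X_def)
    then have "c * L - 1 = c * (L - X k) - (1 - c) ^ k" by (simp add: algebra_simps)
    then have "2 ^ k dvd c * L - 1"
      using L[of k] pow[of k] by (simp add: dvd_diff)
    then show ?thesis by (simp add: two_power_dvd_diff_iff)
  qed
  then have "c * L = 1" by (rule two_adic_int_eqI)
  then show ?thesis by (rule that)
qed

lemma two_dvd_or_two_dvd_diff_1: "2 dvd x \<or> 2 dvd 1 - (x :: two_adic_int)"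
proof -
  have "residue x 1 = 0 \<or> residue x 1 = residue 1 1"
    using residue_bounds[of x 1] by (auto simp: residue_1)
  then show ?thesis
    using two_power_dvd_iff[of 1 x] two_power_dvd_diff_iff[of 1 1 x] by auto
qed


section \<open>The 2-adic absolute values of integers and factorials\<close>

lemma to_two_adic_simps [simp]:
  "to_two_adic 0 = 0" "to_two_adic 1 = 1"
  "to_two_adic (x + y) = to_two_adic x + to_two_adic y"
  "to_two_adic (x - y) = to_two_adic x - to_two_adic y"
  "to_two_adic (- x) = - to_two_adic x"
  "to_two_adic (x * y) = to_two_adic x * to_two_adic y"
  by (simp_all add: to_two_adic_def Zero_fract_def One_fract_def)

lemma to_two_adic_of_nat [simp]: "to_two_adic (of_nat n) = of_nat n"
  by (induction n) simp_all

lemma to_two_adic_power [simp]: "to_two_adic (x ^ n) = to_two_adic x ^ n"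
  by (induction n) simp_all

lemma to_two_adic_sum: "to_two_adic (sum f A) = (\<Sum>i\<in>A. to_two_adic (f i))"
  by (induction A rule: infinite_finite_induct) simp_all

lemma to_two_adic_eq_iff [simp]: "to_two_adic x = to_two_adic y \<longleftrightarrow> x = y"
  by (simp add: to_two_adic_def eq_fract)

lemma fract_absval_to_two_adic [simp]: "fract_absval (to_two_adic x) = absval x"
  by (simp add: to_two_adic_def fract_absval_Fract)

text \<open>
  In \<open>a / b\<close> the power of 2 in \<open>b\<close> cancels, and what remains of \<open>b\<close> is a unit.
\<close>

lemma fract_absval_two_adic_le_1_iff: "fract_absval q \<le> 1 \<longleftrightarrow> (\<exists>x. q = to_two_adic x)"
proof
  assume "\<exists>x. q = to_two_adic x"
  then show "fract_absval q \<le> 1" using absval_le_iff[of _ 0] by auto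
next
  assume q: "fract_absval q \<le> 1"
  obtain a b where ab: "q = Fraction_Field.Fract a b" "b \<noteq> 0" by (cases q)
  obtain b' where b': "b = 2 ^ val2 b * b'"
    using val2_props(1)[OF ab(2)] by (auto elim: dvdE)
  have "\<not> 2 dvd b'"
  proof
    assume "2 dvd b'"
    then have "2 ^ Suc (val2 b) dvd b" by (subst b') (simp add: mult_dvd_mono mult.commute)
    then show False using val2_props(2)[OF ab(2)] by fastforce
  qed
  then obtain d where d: "b' * d = 1"
    using two_adic_int_inverse two_dvd_or_two_dvd_diff_1 by blast
  have "absval b > 0" using ab absval_nonneg[of b] by (simp add: less_le)
  then have "absval a \<le> (1 / 2) ^ val2 b"
    using q ab by (simp add: fract_absval_Fract absval_two_adic_int_def)
  then obtain a' where "a = 2 ^ val2 b * a'" by (auto simp: absval_le_iff elim: dvdE)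
  then have "a = a' * d * b" by (subst b') (simp add: d algebra_simps)
  then have "q = to_two_adic (a' * d)"
    using ab by (simp add: to_two_adic_def eq_fract del: to_two_adic_simps)
  then show "\<exists>x. q = to_two_adic x" ..
qed

lemma fract_absval_two: "fract_absval (2 :: two_adic) = 1 / 2"
proof -
  have "val2 2 = 1"
    using two_power_dvd_of_nat_iff[of 2 2] by (intro val2_eqI) (auto simp: numeral_2_eq_2[symmetric])
  moreover have "(2 :: two_adic_int) \<noteq> 0"
    using two_power_dvd_of_nat_iff[of 2 2] by auto
  ultimately have "absval (2 :: two_adic_int) = 1 / 2"
    by (simp add: absval_two_adic_int_def)
  moreover have "(2 :: two_adic) = to_two_adic 2"
    using to_two_adic_of_nat[of 2] by simp
  ultimately show ?thesis by (metis fract_absval_to_two_adic)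
qed

text \<open>
  The power of 2 dividing \<open>n\<close> is at most \<open>n\<close>. This controls the denominators of the logarithm
  series.
\<close>

lemma fract_absval_of_nat_ge:
  assumes "n > 0"
  shows "1 / real n \<le> fract_absval (of_nat n :: two_adic)"
proof -
  let ?n = "of_nat n :: two_adic_int"
  have nz: "?n \<noteq> 0"
  proof
    assume "?n = 0"
    then have "2 ^ n dvd n" using two_power_dvd_of_nat_iff[of n n] by simp
    then show False using assms by (metis dvd_imp_le less_exp not_less)
  qed
  then have "2 ^ val2 ?n \<le> n"
    using val2_props(1)[OF nz] assms by (auto simp: two_power_dvd_of_nat_iff intro: dvd_imp_le)
  then have "2 ^ val2 ?n \<le> real n" by (metis of_nat_le_iff of_nat_numeral of_nat_power)
  then have "1 / real n \<le> (1 / 2) ^ val2 ?n"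
    using assms by (simp add: field_simps power_divide)
  also have "\<dots> = fract_absval (to_two_adic ?n)"
    using nz by (simp add: absval_two_adic_int_def del: to_two_adic_of_nat)
  finally show ?thesis by simp
qed

lemma of_nat_two_adic_eq_0_iff [simp]: "of_nat n = (0 :: two_adic) \<longleftrightarrow> n = 0"
  using fract_absval_of_nat_ge[of n] by (cases "n = 0") auto

lemma fract_absval_odd:
  assumes "odd n"
  shows "fract_absval (of_nat n :: two_adic) = 1"
proof -
  let ?n = "of_nat n :: two_adic_int"
  have "\<not> 2 ^ Suc 0 dvd ?n" using assms by (subst two_power_dvd_of_nat_iff) simp
  then have "val2 ?n = 0" "?n \<noteq> 0" using val2_eqI[of 0 ?n] by auto
  then have "fract_absval (to_two_adic ?n) = 1"
    by (simp add: absval_two_adic_int_def del: to_two_adic_of_nat)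
  then show ?thesis by simp
qed

text \<open>
  The factorial of \<open>k\<close> is divisible by 2 at most \<open>k - 1\<close> times: the even factors of \<open>(2 * m)!\<close>
  are twice the factors of \<open>m!\<close>, so its valuation is \<open>m\<close> plus that of \<open>m!\<close>.
  For \<open>k = 0\<close> the truncated subtraction gives the correct bound 1.
\<close>

lemma fract_absval_fact_ge: "(1 / 2) ^ (k - 1) \<le> fract_absval (of_nat (fact k) :: two_adic)"
proof (induction k rule: less_induct)
  case (less k)
  have even: "fract_absval (of_nat (fact (2 * m)) :: two_adic) =
      (1 / 2) ^ m * fract_absval (of_nat (fact m) :: two_adic)" for m
  proof (induction m)
    case (Suc m)
    have "(fact (2 * Suc m) :: nat) = 2 * Suc m * ((2 * m + 1) * fact (2 * m))"
      by (simp add: algebra_simps)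
    then have "fract_absval (of_nat (fact (2 * Suc m)) :: two_adic) =
      1 / 2 * fract_absval (of_nat (Suc m) :: two_adic) * (1 * fract_absval (of_nat (fact (2 * m)) :: two_adic))"
      using fract_absval_odd[of "2 * m + 1"]
      by (simp only: of_nat_mult fract_absval_mult of_nat_numeral fract_absval_two) simp
    then show ?case by (simp only: Suc fact_Suc of_nat_mult fract_absval_mult of_nat_id) simp
  qed simp
  have odd: "fract_absval (of_nat (fact (2 * m + 1)) :: two_adic) =
      fract_absval (of_nat (fact (2 * m)) :: two_adic)" for m
  proof -
    have "(fact (2 * m + 1) :: nat) = (2 * m + 1) * fact (2 * m)" by simp
    then show ?thesis
      using fract_absval_odd[of "2 * m + 1"]
      by (simp only: of_nat_mult fract_absval_mult) simp
  qed
  show ?case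
  proof (cases "k \<le> 1")
    case True
    then show ?thesis by (auto simp: le_Suc_eq)
  next
    case False
    define m where "m = k div 2"
    have m: "m \<ge> 1" "m < k" using False by (auto simp: m_def)
    have "k = 2 * m \<or> k = 2 * m + 1" by (auto simp: m_def)
    then have k: "fract_absval (of_nat (fact k) :: two_adic) =
        (1 / 2) ^ m * fract_absval (of_nat (fact m) :: two_adic)" "k - 1 \<ge> m + (m - 1)"
      using even[of m] odd[of m] by auto
    have "(1 / 2 :: real) ^ (k - 1) \<le> (1 / 2) ^ (m + (m - 1))"
      using k(2) by (intro power_decreasing) auto
    also have "\<dots> = (1 / 2) ^ m * (1 / 2) ^ (m - 1)" by (rule power_add)
    also have "\<dots> \<le> fract_absval (of_nat (fact k) :: two_adic)"
      unfolding k(1) by (intro mult_left_mono less.IH m) simp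
    finally show ?thesis .
  qed
qed


section \<open>Infinite sums in the 2-adic numbers\<close>

text \<open>
  The terms are 2-adic integers, so their partial sums have a limit by completeness, and in an
  ultrametric the error of a truncation is at most the largest omitted term.
\<close>

lemma two_adic_suminf_truncation:
  fixes f :: "nat \<Rightarrow> two_adic"
  assumes "\<And>i. fract_absval (f i) \<le> (1 / 2) ^ i"
  shows "fract_absval (suminf f - sum f {..<m}) \<le> (1 / 2) ^ m"
proof -
  have "\<exists>h. f i = to_two_adic h" for i
  proof -
    have "(1 / 2 :: real) ^ i \<le> 1" by (simp add: power_le_one)
    then show ?thesis using assms[of i] fract_absval_two_adic_le_1_iff[of "f i"] by simp
  qed
  then obtain h where h: "\<And>i. f i = to_two_adic (h i)" by metis
  define X where "X k = sum h {..<k}" for k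
  have "2 ^ k dvd h k" for k
    using assms[of k] by (simp add: h flip: absval_le_iff)
  then have "2 ^ k dvd X (Suc k) - X k" for k by (simp add: X_def)
  then obtain L where L: "\<And>k. 2 ^ k dvd L - X k" using two_adic_int_limit[of X] by blast
  have err: "fract_absval (to_two_adic L - sum f {..<m}) \<le> (1 / 2) ^ m" for m
  proof -
    have "to_two_adic L - sum f {..<m} = to_two_adic (L - X m)"
      by (simp add: X_def h to_two_adic_sum)
    then show ?thesis using L[of m] by (simp only: fract_absval_to_two_adic absval_le_iff)
  qed
  have "f sums to_two_adic L"
    unfolding sums_def
  proof (rule metric_LIMSEQ_I)
    fix r :: real assume "r > 0"
    then obtain N where N: "(1 / 2 :: real) ^ N < r" using real_arch_pow_inv[of r "1/2"] by auto
    have "dist (sum f {..<m}) (to_two_adic L) < r" if "m \<ge> N" for m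
    proof -
      have "dist (sum f {..<m}) (to_two_adic L) \<le> (1 / 2) ^ m"
        using err[of m] by (simp add: dist_commute[of "sum f {..<m}"]) (simp add: dist_fract_def)
      also have "\<dots> \<le> (1 / 2) ^ N" using that by (intro power_decreasing) auto
      finally show ?thesis using N by simp
    qed
    then show "\<exists>no. \<forall>n\<ge>no. dist (sum f {..<n}) (to_two_adic L) < r" by blast
  qed
  then have "suminf f = to_two_adic L" by (simp add: sums_iff)
  then show ?thesis using err by simp
qed

text \<open>
  Closed balls are closed under addition and under limits; a tail whose terms all lie in the ball
  of radius \<open>c\<close> therefore sums to an element of that ball.
\<close>

lemma two_adic_suminf_tail_le:
  fixes f :: "nat \<Rightarrow> two_adic"
  assumes "\<And>i. fract_absval (f i) \<le> (1 / 2) ^ i" "\<And>i. i \<ge> N \<Longrightarrow> fract_absval (f i) \<le> c"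
  shows "fract_absval (suminf f - sum f {..<N}) \<le> c"
proof (rule ccontr)
  assume *: "\<not> ?thesis"
  let ?d = "suminf f - sum f {..<N}"
  have c: "0 \<le> c" using assms(2)[of N] fract_absval_nonneg[of "f N"] by simp
  then obtain m where m: "(1 / 2 :: real) ^ m < fract_absval ?d"
    using real_arch_pow_inv[of "fract_absval ?d" "1/2"] * by auto
  \<comment> \<open>Cutting the series so late that the rest is smaller than the supposed counterexample.\<close>
  define M where "M = max m N"
  have "sum f {..<M} = sum f {..<N} + sum f {N..<M}"
    unfolding M_def by (simp add: sum.atLeastLessThan_concat flip: atLeast0LessThan)
  then have d: "(suminf f - sum f {..<M}) + sum f {N..<M} = ?d" by simp
  have "fract_absval (suminf f - sum f {..<M}) < fract_absval ?d"
  proof -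
    have "fract_absval (suminf f - sum f {..<M}) \<le> (1 / 2) ^ M"
      by (rule two_adic_suminf_truncation[OF assms(1)])
    also have "\<dots> \<le> (1 / 2) ^ m" by (intro power_decreasing) (auto simp: M_def)
    finally show ?thesis using m by simp
  qed
  moreover have "fract_absval (sum f {N..<M}) \<le> c"
    by (rule fract_absval_sum_le_bound) (auto simp: assms(2) c)
  ultimately show False
    using * fract_absval_add_le_max[of "suminf f - sum f {..<M}" "sum f {N..<M}", unfolded d]
    by linarith
qed


section \<open>Estimates of the series and the 2-adic exponential\<close>

lemma exp_term_bound:
  fixes t :: two_adic
  shows "fract_absval (t ^ Suc k / of_nat (fact (Suc k))) \<le> fract_absval t * (2 * fract_absval t) ^ k"
proof -
  have "(1 / 2) ^ k \<le> fract_absval (of_nat (fact (Suc k)) :: two_adic)"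
    using fract_absval_fact_ge[of "Suc k"] by (simp del: fact_Suc)
  then have "fract_absval (t ^ Suc k / of_nat (fact (Suc k))) \<le> fract_absval t ^ Suc k / (1 / 2) ^ k"
    unfolding fract_absval_divide fract_absval_power
    by (intro frac_le zero_le_power fract_absval_nonneg) simp_all
  then show ?thesis by (simp add: power_mult_distrib power_divide mult_ac)
qed

lemma log_term_bound:
  fixes v :: two_adic
  shows "fract_absval ((- 1) ^ k * v ^ Suc k / of_nat (Suc k)) \<le> fract_absval v * (2 * fract_absval v) ^ k"
proof -
  have k: "1 / real (Suc k) \<le> fract_absval (of_nat (Suc k) :: two_adic)"
    by (rule fract_absval_of_nat_ge) simp
  have "real (Suc k) \<le> 2 ^ k"
    by (metis Suc_leI less_exp of_nat_le_iff of_nat_numeral of_nat_power)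
  have "fract_absval ((- 1) ^ k * v ^ Suc k / of_nat (Suc k)) =
      fract_absval v ^ Suc k / fract_absval (of_nat (Suc k) :: two_adic)"
    by (simp only: fract_absval_divide fract_absval_power fract_absval_mult fract_absval_minus
        fract_absval_1 power_one mult_1)
  also have "\<dots> \<le> fract_absval v ^ Suc k / (1 / real (Suc k))"
    using k by (intro frac_le zero_le_power fract_absval_nonneg) simp_all
  also have "\<dots> = fract_absval v ^ Suc k * real (Suc k)" by simp
  also have "\<dots> \<le> fract_absval v ^ Suc k * 2 ^ k"
    using \<open>real (Suc k) \<le> 2 ^ k\<close> fract_absval_nonneg[of v] by (intro mult_left_mono) auto
  finally show ?thesis by (simp add: power_mult_distrib mult_ac)
qed

text \<open>
  On the disc of radius \<open>1 / 4\<close> the terms of the exponential and of the logarithm series are both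
  dominated by \<open>r * (2 * r) ^ k\<close>. The three estimates give convergence, a bound for the terms of
  positive degree, and a bound for the terms of degree at least 2.
\<close>

lemma geometric_bound:
  fixes r :: real
  assumes "0 \<le> r" "r \<le> 1 / 4"
  shows "r * (2 * r) ^ k \<le> (1 / 2) ^ Suc k" "r * (2 * r) ^ k \<le> r" "r * (2 * r) ^ Suc k \<le> 2 * r\<^sup>2"
proof -
  have "(2 * r) ^ k \<le> (1 / 2) ^ k" using assms by (intro power_mono) auto
  then have "r * (2 * r) ^ k \<le> (1 / 2) * (1 / 2) ^ k" using assms by (intro mult_mono) auto
  then show "r * (2 * r) ^ k \<le> (1 / 2) ^ Suc k" by simp
  have p: "(2 * r) ^ k \<le> 1" using assms by (intro power_le_one) auto
  show 1: "r * (2 * r) ^ k \<le> r" using mult_left_mono[OF p assms(1)] by simp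
  have "2 * r * (r * (2 * r) ^ k) \<le> 2 * r * r" using 1 assms(1) by (intro mult_left_mono) auto
  then show "r * (2 * r) ^ Suc k \<le> 2 * r\<^sup>2" by (simp add: power2_eq_square mult_ac)
qed

context
  fixes t :: two_adic
  assumes t: "fract_absval t \<le> 1 / 4"
begin

lemma exp_term_le_half_power: "fract_absval (t ^ k / of_nat (fact k)) \<le> (1 / 2) ^ k"
proof (cases k)
  case (Suc j)
  then show ?thesis
    using exp_term_bound[of t j] geometric_bound(1)[of "fract_absval t" j] t fract_absval_nonneg[of t]
    by simp
qed simp

lemma log_term_le_half_power:
  "fract_absval ((- 1) ^ k * t ^ Suc k / of_nat (Suc k)) \<le> (1 / 2) ^ Suc k"
  using order_trans[OF log_term_bound[of k t] geometric_bound(1)[of "fract_absval t" k]] t fract_absval_nonneg[of t]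
  by simp

lemma exp_2adic_truncation:
  "fract_absval (exp_2adic t - (\<Sum>k<N. t ^ k / of_nat (fact k))) \<le> (1 / 2) ^ N"
  unfolding exp_2adic_def by (rule two_adic_suminf_truncation[OF exp_term_le_half_power])

lemma exp_2adic_minus_1: "fract_absval (exp_2adic t - 1) \<le> fract_absval t"
proof -
  have "fract_absval (exp_2adic t - (\<Sum>k<1. t ^ k / of_nat (fact k))) \<le> fract_absval t"
    unfolding exp_2adic_def
  proof (rule two_adic_suminf_tail_le[OF exp_term_le_half_power])
    fix i :: nat assume "i \<ge> 1"
    then obtain j where "i = Suc j" by (cases i) auto
    then show "fract_absval (t ^ i / of_nat (fact i)) \<le> fract_absval t"
      using order_trans[OF exp_term_bound geometric_bound(2)] t fract_absval_nonneg by blast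
  qed
  then show ?thesis by simp
qed

lemma exp_2adic_minus_linear: "fract_absval (exp_2adic t - 1 - t) \<le> 2 * (fract_absval t)\<^sup>2"
proof -
  have "fract_absval (exp_2adic t - (\<Sum>k<2. t ^ k / of_nat (fact k))) \<le> 2 * (fract_absval t)\<^sup>2"
    unfolding exp_2adic_def
  proof (rule two_adic_suminf_tail_le[OF exp_term_le_half_power])
    fix i :: nat assume "i \<ge> 2"
    then obtain j where "i = Suc (Suc j)" by (metis add_2_eq_Suc le_Suc_ex)
    then show "fract_absval (t ^ i / of_nat (fact i)) \<le> 2 * (fract_absval t)\<^sup>2"
      using order_trans[OF exp_term_bound geometric_bound(3)] t fract_absval_nonneg by blast
  qed
  then show ?thesis by (simp add: numeral_2_eq_2 diff_diff_eq)
qed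

end

lemma exp_2adic_0 [simp]: "exp_2adic 0 = 1"
  using exp_2adic_minus_1[of 0] fract_absval_nonneg[of "exp_2adic 0 - 1"] by simp

text \<open>
  The usual Cauchy product: the product of the truncations at \<open>N\<close> differs from the truncation of
  \<open>exp (s + t)\<close> by the terms \<open>s ^ i * t ^ j / (i! * j!)\<close> with \<open>i, j < N \<le> i + j\<close>, and these are
  at most \<open>(1 / 2) ^ N\<close>.
\<close>

lemma exp_2adic_add:
  assumes s: "fract_absval s \<le> 1 / 4" and t: "fract_absval t \<le> 1 / 4"
  shows "exp_2adic (s + t) = exp_2adic s * exp_2adic t"
proof -
  let ?E = "\<lambda>N t. \<Sum>k<N. t ^ k / of_nat (fact k) :: two_adic"
  have st: "fract_absval (s + t) \<le> 1 / 4" by (rule fract_absval_add_le_bound[OF s t])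
  have E_le_1: "fract_absval (?E N t) \<le> 1" if "fract_absval t \<le> 1 / 4" for N t
    by (rule fract_absval_sum_le_bound)
      (auto intro!: order_trans[OF exp_term_le_half_power[OF that]] power_le_one)
  have product: "fract_absval (?E N s * ?E N t - ?E N (s + t)) \<le> (1 / 2) ^ N" for N
  proof -
    define a where "a = (\<lambda>(i, j). s ^ i / of_nat (fact i) * (t ^ j / of_nat (fact j)))"
    have "?E N (s + t) = (\<Sum>k<N. \<Sum>i\<le>k. a (i, k - i))"
    proof (rule sum.cong[OF refl])
      fix k
      have "(s + t) ^ k / of_nat (fact k) = (\<Sum>i\<le>k. of_nat (k choose i) * s ^ i * t ^ (k - i) / of_nat (fact k))"
        by (simp add: binomial_ring sum_divide_distrib)
      also have "\<dots> = (\<Sum>i\<le>k. a (i, k - i))"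
      proof (rule sum.cong[OF refl])
        fix i assume "i \<in> {..k}"
        then have f: "of_nat (fact k) = (of_nat (fact i * fact (k - i) * (k choose i)) :: two_adic)"
          by (simp add: binomial_fact_lemma)
        have "k choose i \<noteq> 0" using \<open>i \<in> {..k}\<close> by simp
        then show "of_nat (k choose i) * s ^ i * t ^ (k - i) / of_nat (fact k) = a (i, k - i)"
          unfolding f a_def of_nat_mult by (simp add: field_simps)
      qed
      finally show "(s + t) ^ k / of_nat (fact k) = (\<Sum>i\<le>k. a (i, k - i))" .
    qed
    also have "\<dots> = sum a {(i, j). i + j < N}"
      using sum.triangle_reindex[of "\<lambda>i j. a (i, j)" N] by simp
    finally have 1: "?E N (s + t) = sum a {(i, j). i + j < N}" .
    have 2: "?E N s * ?E N t = sum a ({..<N} \<times> {..<N})"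
      by (simp add: a_def sum_product sum.cartesian_product)
    have "?E N s * ?E N t - ?E N (s + t) = sum a ({..<N} \<times> {..<N} - {(i, j). i + j < N})"
      unfolding 1 2 by (subst sum_diff) auto
    also have "fract_absval \<dots> \<le> (1 / 2) ^ N"
    proof (rule fract_absval_sum_le_bound)
      fix p assume "p \<in> {..<N} \<times> {..<N} - {(i, j). i + j < N}"
      then obtain i j where p: "p = (i, j)" "i + j \<ge> N" by (cases p) auto
      have "fract_absval (a p) \<le> (1 / 2) ^ i * (1 / 2) ^ j"
        unfolding p a_def prod.case fract_absval_mult
        by (intro mult_mono exp_term_le_half_power s t fract_absval_nonneg) auto
      also have "\<dots> \<le> (1 / 2) ^ N"
        unfolding power_add[symmetric] using p by (intro power_decreasing) auto
      finally show "fract_absval (a p) \<le> (1 / 2) ^ N" .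
    qed simp
    finally show ?thesis .
  qed
  have "exp_2adic (s + t) - exp_2adic s * exp_2adic t = 0"
  proof (rule fract_eq_0_if_small)
    fix N
    let ?ds = "exp_2adic s - ?E N s" and ?dt = "exp_2adic t - ?E N t"
    let ?dst = "exp_2adic (s + t) - ?E N (s + t)"
    have "fract_absval (exp_2adic t) \<le> 1"
      using fract_absval_add_le_bound[of "exp_2adic t - 1" 1 1] exp_2adic_minus_1[OF t] t by simp
    then have "fract_absval (?ds * exp_2adic t) \<le> (1 / 2) ^ N * 1"
      unfolding fract_absval_mult
      by (intro mult_mono exp_2adic_truncation s fract_absval_nonneg) auto
    moreover have "fract_absval (?E N s * ?dt) \<le> 1 * (1 / 2) ^ N"
      unfolding fract_absval_mult
      by (intro mult_mono exp_2adic_truncation E_le_1 s t fract_absval_nonneg) auto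
    moreover have "fract_absval ?dst \<le> (1 / 2) ^ N" by (rule exp_2adic_truncation[OF st])
    moreover have "exp_2adic (s + t) - exp_2adic s * exp_2adic t =
        ?dst - ?ds * exp_2adic t - ?E N s * ?dt - (?E N s * ?E N t - ?E N (s + t))"
      by (simp add: algebra_simps)
    ultimately show "fract_absval (exp_2adic (s + t) - exp_2adic s * exp_2adic t) \<le> (1 / 2) ^ N"
      using product[of N] by (simp only: mult_1 mult_1_right fract_absval_diff_le_bound)
  qed
  then show ?thesis by simp
qed

lemma fract_absval_of_nat_mult_le:
  assumes "fract_absval t \<le> c"
  shows "fract_absval (of_nat n * t) \<le> c"
  using mult_mono[OF fract_absval_of_nat_le_1[of n] assms] fract_absval_nonneg[of t]
  by (simp add: fract_absval_mult)

lemma exp_2adic_of_nat_mult: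
  assumes "fract_absval t \<le> 1 / 4"
  shows "exp_2adic (of_nat n * t) = exp_2adic t ^ n"
proof (induction n)
  case (Suc n)
  have "exp_2adic (of_nat (Suc n) * t) = exp_2adic (t + of_nat n * t)" by (simp add: algebra_simps)
  also have "\<dots> = exp_2adic t * exp_2adic (of_nat n * t)"
    by (rule exp_2adic_add[OF assms fract_absval_of_nat_mult_le[OF assms]])
  finally show ?case by (simp add: Suc)
qed simp


section \<open>The 2-adic logarithm\<close>

lemma log_2adic_minus_linear:
  assumes "fract_absval (u - 1) \<le> 1 / 4"
  shows "fract_absval (log_2adic u - (u - 1)) \<le> 2 * (fract_absval (u - 1))\<^sup>2"
proof -
  let ?f = "\<lambda>k. (- 1) ^ k * (u - 1) ^ Suc k / of_nat (Suc k)"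
  have "fract_absval (log_2adic u - (\<Sum>k<1. ?f k)) \<le> 2 * (fract_absval (u - 1))\<^sup>2"
    unfolding log_2adic_def
  proof (rule two_adic_suminf_tail_le)
    show "fract_absval (?f i) \<le> (1 / 2) ^ i" for i
      using log_term_le_half_power[OF assms, of i] by (rule order_trans) simp
    fix i :: nat assume "i \<ge> 1"
    then obtain j where "i = Suc j" by (cases i) auto
    then show "fract_absval (?f i) \<le> 2 * (fract_absval (u - 1))\<^sup>2"
      using order_trans[OF log_term_bound geometric_bound(3)] assms fract_absval_nonneg by blast
  qed
  then show ?thesis by simp
qed

text \<open>
  Near 1 the linear term of the logarithm dominates: the other terms are at most half as large as
  \<open>u - 1\<close>.
\<close>

lemma log_2adic_eq_0_iff:
  assumes "fract_absval (u - 1) \<le> 1 / 4"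
  shows "log_2adic u = 0 \<longleftrightarrow> u = 1"
proof
  assume "log_2adic u = 0"
  define r where "r = fract_absval (u - 1)"
  have "r \<le> 2 * r\<^sup>2"
    using log_2adic_minus_linear[OF assms] \<open>log_2adic u = 0\<close> unfolding r_def
    by (simp only: diff_0 fract_absval_minus)
  also have "2 * r\<^sup>2 \<le> r / 2"
    using mult_left_mono[of r "1 / 4" "2 * r"] assms fract_absval_nonneg[of "u - 1"]
    by (simp add: r_def power2_eq_square)
  finally have "r = 0" using fract_absval_nonneg[of "u - 1"] by (simp add: r_def)
  then show "u = 1" by (simp add: r_def)
next
  assume "u = 1"
  then show "log_2adic u = 0"
    using log_2adic_minus_linear[of 1] fract_absval_nonneg[of "log_2adic 1"] by simp
qed

lemma fract_absval_log_2adic_le: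
  assumes "fract_absval (u - 1) \<le> 1 / 4"
  shows "fract_absval (log_2adic u) \<le> 1 / 4"
proof -
  have "(fract_absval (u - 1))\<^sup>2 \<le> (1 / 4)\<^sup>2"
    using assms fract_absval_nonneg by (rule power_mono)
  then have "fract_absval (log_2adic u - (u - 1)) \<le> 1 / 4"
    using log_2adic_minus_linear[OF assms] by (simp add: power2_eq_square)
  from fract_absval_add_le_bound[OF this assms] show ?thesis by simp
qed

lemma fract_absval_two_power: "fract_absval (of_nat (2 ^ m) :: two_adic) = (1 / 2) ^ m"
  by (simp add: fract_absval_power fract_absval_two)

text \<open>
  Modulo a high power of 2 the binomial coefficients of \<open>2 ^ m - 1\<close> are those of \<open>-1\<close>: by Pascal's rule
  the sum of two neighbouring ones is a binomial coefficient of \<open>2 ^ m\<close>, which is nearly divisible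
  by \<open>2 ^ m\<close>.
\<close>

lemma binomial_two_power_minus_1_approx:
  "fract_absval (of_nat ((2 ^ m - 1) choose j) - (- 1) ^ j :: two_adic) \<le> (1 / 2) ^ m * real (Suc j)"
proof (induction j)
  case (Suc j)
  define N :: nat where "N = 2 ^ m"
  have N: "N = Suc (2 ^ m - 1)" by (simp add: N_def)
  let ?C = "\<lambda>i j. of_nat (i choose j) :: two_adic"
  have pascal: "?C N (Suc j) = ?C (2 ^ m - 1) j + ?C (2 ^ m - 1) (Suc j)"
    by (metis N binomial_Suc_Suc of_nat_add)
  have "of_nat (Suc j) * ?C N (Suc j) = of_nat N * ?C (2 ^ m - 1) j"
    by (metis N Suc_times_binomial of_nat_mult)
  then have "?C N (Suc j) = of_nat N * ?C (2 ^ m - 1) j / of_nat (Suc j)"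
    using of_nat_two_adic_eq_0_iff[of "Suc j"] by (simp add: field_simps del: of_nat_Suc)
  then have "fract_absval (?C N (Suc j)) =
      (1 / 2) ^ m * fract_absval (?C (2 ^ m - 1) j) / fract_absval (of_nat (Suc j) :: two_adic)"
    by (simp only: fract_absval_divide fract_absval_mult N_def fract_absval_two_power)
  also have "\<dots> \<le> (1 / 2) ^ m * 1 / (1 / real (Suc j))"
    using fract_absval_of_nat_ge[of "Suc j"]
    by (intro frac_le mult_left_mono fract_absval_of_nat_le_1) auto
  also have "\<dots> \<le> (1 / 2) ^ m * real (Suc (Suc j))" by simp
  finally have 1: "fract_absval (?C N (Suc j)) \<le> (1 / 2) ^ m * real (Suc (Suc j))" .
  have "(1 / 2) ^ m * real (Suc j) \<le> (1 / 2) ^ m * real (Suc (Suc j))" by simp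
  then have 2: "fract_absval (?C (2 ^ m - 1) j - (- 1) ^ j) \<le> (1 / 2) ^ m * real (Suc (Suc j))"
    using Suc by linarith
  have "?C (2 ^ m - 1) (Suc j) - (- 1) ^ Suc j = ?C N (Suc j) - (?C (2 ^ m - 1) j - (- 1) ^ j)"
    unfolding pascal by simp
  then show ?case using fract_absval_diff_le_bound[OF 1 2] by (simp only:)
qed simp

text \<open>
  The logarithm is the limit of \<open>(u ^ (2 ^ m) - 1) / 2 ^ m\<close>, the derivative at 0 of the powers of
  \<open>u\<close>. Expanding the power by the binomial theorem and dividing by \<open>N = 2 ^ m\<close>, the
  coefficient of \<open>(u - 1) ^ (j + 1)\<close> is a binomial coefficient of \<open>N - 1\<close> over \<open>j + 1\<close>, which
  is close to \<open>(-1) ^ j / (j + 1)\<close>. The functional equations of the logarithm then reduce to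
  identities between powers, with no composition of power series.
\<close>

lemma log_2adic_approx:
  assumes u: "fract_absval (u - 1) \<le> 1 / 4"
  shows "fract_absval (log_2adic u - (u ^ (2 ^ m) - 1) / of_nat (2 ^ m)) \<le> (1 / 2) ^ m"
proof -
  define v where "v = u - 1"
  define N :: nat where "N = 2 ^ m"
  have v: "fract_absval v \<le> 1 / 4" using u by (simp add: v_def)
  let ?f = "\<lambda>k. (- 1) ^ k * v ^ Suc k / of_nat (Suc k)"
  let ?C = "\<lambda>i j. of_nat (i choose j) :: two_adic"
  have N0: "of_nat N \<noteq> (0 :: two_adic)" unfolding of_nat_two_adic_eq_0_iff by (simp add: N_def)
  have "fract_absval (log_2adic u - (\<Sum>k<N. ?f k)) \<le> (1 / 2) ^ N"
    unfolding log_2adic_def v_def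
    by (rule two_adic_suminf_truncation) (rule order_trans[OF log_term_le_half_power[OF u]], simp)
  also have "\<dots> \<le> (1 / 2) ^ m"
    unfolding N_def by (intro power_decreasing) (auto simp: less_imp_le)
  finally have 1: "fract_absval (log_2adic u - (\<Sum>k<N. ?f k)) \<le> (1 / 2) ^ m" .
  have "u ^ N = (v + 1) ^ N" by (simp add: v_def)
  also have "\<dots> = (\<Sum>k\<le>N. ?C N k * v ^ k)" by (simp add: binomial_ring)
  also have "\<dots> = 1 + (\<Sum>j<N. ?C N (Suc j) * v ^ Suc j)"
    by (simp add: sum.atMost_shift)
  finally have "(u ^ N - 1) / of_nat N = (\<Sum>j<N. ?C N (Suc j) * v ^ Suc j / of_nat N)"
    by (simp add: sum_divide_distrib)
  also have "\<dots> = (\<Sum>j<N. ?C (N - 1) j * v ^ Suc j / of_nat (Suc j))"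
  proof (rule sum.cong[OF refl])
    fix j
    have "of_nat (Suc j) * ?C N (Suc j) = of_nat N * ?C (N - 1) j"
      by (metis binomial_absorption of_nat_mult)
    then have "?C N (Suc j) / of_nat N = ?C (N - 1) j / of_nat (Suc j)"
      using N0 of_nat_two_adic_eq_0_iff[of "Suc j"]
      by (simp add: frac_eq_eq mult.commute del: of_nat_Suc)
    then show "?C N (Suc j) * v ^ Suc j / of_nat N = ?C (N - 1) j * v ^ Suc j / of_nat (Suc j)"
      by (metis times_divide_eq_left)
  qed
  finally have "(u ^ N - 1) / of_nat N - (\<Sum>k<N. ?f k) =
      (\<Sum>j<N. (?C (N - 1) j - (- 1) ^ j) * (v ^ Suc j / of_nat (Suc j)))"
    by (simp add: sum_subtractf left_diff_distrib diff_divide_distrib)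
  also have "fract_absval \<dots> \<le> (1 / 2) ^ m"
  proof (rule fract_absval_sum_le_bound)
    fix j
    have "fract_absval (v ^ Suc j / of_nat (Suc j)) \<le> (1 / 4) ^ Suc j / (1 / real (Suc j))"
      unfolding fract_absval_divide fract_absval_power
      using fract_absval_of_nat_ge[of "Suc j"]
      by (intro frac_le power_mono v fract_absval_nonneg) auto
    then have "fract_absval ((?C (N - 1) j - (- 1) ^ j) * (v ^ Suc j / of_nat (Suc j)))
        \<le> ((1 / 2) ^ m * real (Suc j)) * ((1 / 4) ^ Suc j / (1 / real (Suc j)))"
      unfolding fract_absval_mult[of "_ - _"] N_def
      by (intro mult_mono binomial_two_power_minus_1_approx fract_absval_nonneg) auto
    also have "\<dots> = (1 / 2) ^ m * (real (Suc j) / 2 ^ Suc j)\<^sup>2"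
    proof -
      have "(2 ^ Suc j :: real)\<^sup>2 = 4 ^ Suc j"
        by (simp only: power2_eq_square flip: power_mult_distrib) simp
      then show ?thesis by (simp only: power_divide power2_eq_square[of "real (Suc j)"]) simp
    qed
    also have "\<dots> \<le> (1 / 2) ^ m * 1"
    proof -
      have "real (Suc j) < 2 ^ Suc j" by (rule of_nat_less_two_power)
      then have "real (Suc j) / 2 ^ Suc j \<le> 1" by (simp only: divide_le_eq_1) simp
      then show ?thesis by (intro mult_left_mono power_le_one) auto
    qed
    finally show "fract_absval ((?C (N - 1) j - (- 1) ^ j) * (v ^ Suc j / of_nat (Suc j))) \<le> (1 / 2) ^ m"
      by simp
  qed simp
  finally have 2: "fract_absval ((u ^ N - 1) / of_nat N - (\<Sum>k<N. ?f k)) \<le> (1 / 2) ^ m" .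
  show ?thesis
    using fract_absval_diff_le_bound[OF 1 2] by (simp add: N_def)
qed

lemma fract_absval_mult_minus_1_le:
  assumes "fract_absval (u - 1) \<le> c" "fract_absval (w - 1) \<le> c" "c \<le> 1"
  shows "fract_absval (u * w - 1) \<le> c"
proof -
  have "fract_absval u \<le> 1"
    using fract_absval_add_le_bound[of "u - 1" 1 1] assms by simp
  then have "fract_absval (u * (w - 1)) \<le> 1 * c"
    unfolding fract_absval_mult using assms(2) fract_absval_nonneg by (intro mult_mono) auto
  then have "fract_absval (u * (w - 1) + (u - 1)) \<le> c"
    using assms(1) by (intro fract_absval_add_le_bound) auto
  then show ?thesis by (simp add: algebra_simps)
qed

text \<open>
  The quotients \<open>l u = (u ^ N - 1) / N\<close> satisfy \<open>l (u * w) = l u + l w + N * l u * l w\<close>, and the last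
  term vanishes in the limit.
\<close>

lemma log_2adic_mult:
  assumes u: "fract_absval (u - 1) \<le> 1 / 4" and w: "fract_absval (w - 1) \<le> 1 / 4"
  shows "log_2adic (u * w) = log_2adic u + log_2adic w"
proof -
  have uw: "fract_absval (u * w - 1) \<le> 1 / 4"
    using u w by (rule fract_absval_mult_minus_1_le) simp
  have "log_2adic (u * w) - (log_2adic u + log_2adic w) = 0"
  proof (rule fract_eq_0_if_small)
    fix m
    define N :: two_adic where "N = of_nat (2 ^ m)"
    define l where "l u = (u ^ (2 ^ m) - 1) / N" for u
    have N: "N \<noteq> 0" unfolding N_def by (subst of_nat_two_adic_eq_0_iff) simp
    have err: "fract_absval (log_2adic u - l u) \<le> (1 / 2) ^ m" if "fract_absval (u - 1) \<le> 1 / 4" for u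
      using log_2adic_approx[OF that, of m] by (simp only: l_def N_def)
    have l_le_1: "fract_absval (l u) \<le> 1" if "fract_absval (u - 1) \<le> 1 / 4" for u
    proof -
      have "(1 / 2 :: real) ^ m \<le> 1" by (rule power_le_one) auto
      then have "fract_absval (log_2adic u) \<le> 1" "fract_absval (log_2adic u - l u) \<le> 1"
        using fract_absval_log_2adic_le[OF that] err[OF that] by linarith+
      from fract_absval_diff_le_bound[OF this] show ?thesis by simp
    qed
    have "l (u * w) = l u + l w + N * l u * l w"
      using N by (simp add: l_def power_mult_distrib field_simps)
    then have "log_2adic (u * w) - (log_2adic u + log_2adic w) =
        (log_2adic (u * w) - l (u * w)) - (log_2adic u - l u) - (log_2adic w - l w) + N * l u * l w"
      by simp
    moreover have "fract_absval (N * l u * l w) \<le> (1 / 2) ^ m * 1 * 1"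
      unfolding fract_absval_mult N_def fract_absval_two_power
      using l_le_1[OF u] l_le_1[OF w] by (intro mult_mono) (auto simp: fract_absval_nonneg)
    ultimately show "fract_absval (log_2adic (u * w) - (log_2adic u + log_2adic w)) \<le> (1 / 2) ^ m"
      using err[OF u] err[OF w] err[OF uw]
      by (simp only: mult_1_right fract_absval_diff_le_bound fract_absval_add_le_bound)
  qed
  then show ?thesis by simp
qed

lemma log_2adic_power:
  assumes u: "fract_absval (u - 1) \<le> 1 / 4"
  shows "log_2adic (u ^ n) = of_nat n * log_2adic u"
proof -
  have "fract_absval (u ^ n - 1) \<le> 1 / 4 \<and> log_2adic (u ^ n) = of_nat n * log_2adic u"
  proof (induction n)
    case 0
    show ?case using log_2adic_eq_0_iff[of 1] by simp
  next
    case (Suc n)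
    then show ?case
      using fract_absval_mult_minus_1_le[OF u, of "u ^ n"] log_2adic_mult[OF u, of "u ^ n"]
      by (simp add: algebra_simps)
  qed
  then show ?thesis ..
qed

text \<open>
  Since \<open>exp t ^ N = exp (N * t)\<close>, the quotient approximating the logarithm of \<open>exp t\<close> is
  \<open>(exp (N * t) - 1) / N\<close>, which tends to \<open>t\<close> by the linear approximation of the exponential.
\<close>

lemma log_2adic_exp_2adic:
  assumes t: "fract_absval t \<le> 1 / 4"
  shows "log_2adic (exp_2adic t) = t"
proof -
  have E: "fract_absval (exp_2adic t - 1) \<le> 1 / 4" using exp_2adic_minus_1[OF t] t by linarith
  have "log_2adic (exp_2adic t) - t = 0"
  proof (rule fract_eq_0_if_small)
    fix m
    define N :: two_adic where "N = of_nat (2 ^ m)"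
    define l where "l = (exp_2adic t ^ (2 ^ m) - 1) / N"
    have N: "N \<noteq> 0" unfolding N_def by (subst of_nat_two_adic_eq_0_iff) simp
    have absN: "fract_absval N = (1 / 2) ^ m" unfolding N_def by (rule fract_absval_two_power)
    have "l - t = (exp_2adic (N * t) - 1 - N * t) / N"
      using N exp_2adic_of_nat_mult[OF t, of "2 ^ m"] by (simp add: l_def N_def field_simps)
    then have "fract_absval (l - t) = fract_absval (exp_2adic (N * t) - 1 - N * t) / (1 / 2) ^ m"
      by (simp only: fract_absval_divide absN)
    also have "\<dots> \<le> 2 * (fract_absval (N * t))\<^sup>2 / (1 / 2) ^ m"
      using fract_absval_of_nat_mult_le[OF t, of "2 ^ m"]
      by (intro divide_right_mono exp_2adic_minus_linear) (simp_all add: N_def)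
    also have "\<dots> = (1 / 2) ^ m * (2 * (fract_absval t)\<^sup>2)"
      by (simp add: fract_absval_mult absN power2_eq_square)
    also have "\<dots> \<le> (1 / 2) ^ m * 1"
    proof -
      have "(fract_absval t)\<^sup>2 \<le> (1 / 4)\<^sup>2" using t fract_absval_nonneg by (rule power_mono)
      then show ?thesis by (intro mult_left_mono) (auto simp: power2_eq_square)
    qed
    finally have 1: "fract_absval (l - t) \<le> (1 / 2) ^ m" by simp
    have 2: "fract_absval (log_2adic (exp_2adic t) - l) \<le> (1 / 2) ^ m"
      using log_2adic_approx[OF E, of m] by (simp only: l_def N_def)
    from fract_absval_add_le_bound[OF 2 1]
    show "fract_absval (log_2adic (exp_2adic t) - t) \<le> (1 / 2) ^ m" by simp
  qed
  then show ?thesis by simp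
qed


section \<open>The 2-adic solutions\<close>

lemma teich_props:
  assumes "\<not> 2 dvd x"
  shows "teich x \<in> {1, - 1}" "4 dvd teich x - x"
  using theI'[OF ex1_teich[OF assms]] unfolding teich_def by auto

lemma teich_eqI:
  assumes "\<not> 2 dvd x" "w \<in> {1, - 1}" "4 dvd w - x"
  shows "teich x = w"
  unfolding teich_def by (rule the1_equality[OF ex1_teich[OF assms(1)]]) (use assms in auto)

lemma absval_two_adic_int_le_quarter_iff: "absval (x :: two_adic_int) \<le> 1 / 4 \<longleftrightarrow> 4 dvd x"
  using absval_le_iff[of x 2] by (simp add: power2_eq_square)

lemma princ_near_1:
  assumes "\<not> 2 dvd x"
  shows "fract_absval (princ x - 1) \<le> 1 / 4"
proof -
  have "4 dvd x - teich x" using teich_props(2)[OF assms] by (metis dvd_minus_iff minus_diff_eq)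
  then have "fract_absval (to_two_adic (x - teich x)) \<le> 1 / 4"
    by (simp only: fract_absval_to_two_adic absval_two_adic_int_le_quarter_iff)
  moreover have "princ x - 1 = to_two_adic (x - teich x) / to_two_adic (teich x)"
    "fract_absval (to_two_adic (teich x)) = 1"
    using teich_props(1)[OF assms] by (auto simp: princ_def)
  ultimately show ?thesis by (simp add: fract_absval_divide)
qed

text \<open>
  The power \<open>\<langle>x\<rangle> ^ z\<close> lies in \<open>1 + 4\<int>\<^sub>2\<close>, so \<open>y\<close> inherits the sign of \<open>x\<close>, and its principal part is
  that power. Taking logarithms makes the equation linear.
\<close>

lemma log_princ_of_solution:
  assumes x: "\<not> 2 dvd x" and y: "\<not> 2 dvd y"
    and eq: "to_two_adic (teich x) * princ_pow x z = to_two_adic y"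
  shows "teich y = teich x" "log_2adic (princ y) = to_two_adic z * log_2adic (princ x)"
proof -
  define t where "t = to_two_adic z * log_2adic (princ x)"
  have w: "teich x \<in> {1, - 1}" by (rule teich_props(1)[OF x])
  have "fract_absval t \<le> 1 * (1 / 4)"
    unfolding t_def fract_absval_mult
    using fract_absval_log_2adic_le[OF princ_near_1[OF x]] absval_le_iff[of z 0]
    by (intro mult_mono) (auto simp: fract_absval_nonneg)
  then have t: "fract_absval t \<le> 1 / 4" by simp
  have y_eq: "to_two_adic y = to_two_adic (teich x) * exp_2adic t"
    using eq by (simp add: princ_pow_def t_def)
  have "to_two_adic (teich x - y) = to_two_adic (teich x) * - (exp_2adic t - 1)"
    by (simp add: y_eq algebra_simps)
  also have "fract_absval \<dots> \<le> 1 / 4"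
    using exp_2adic_minus_1[OF t] t w by (auto simp: fract_absval_mult simp del: minus_diff_eq)
  finally have "4 dvd teich x - y"
    by (simp only: fract_absval_to_two_adic absval_two_adic_int_le_quarter_iff)
  then show teich: "teich y = teich x" using teich_eqI[OF y w] by simp
  have "princ y = exp_2adic t"
    using w by (auto simp: princ_def teich y_eq)
  then show "log_2adic (princ y) = to_two_adic z * log_2adic (princ x)"
    using log_2adic_exp_2adic[OF t] by (simp add: t_def)
qed

lemma log_princ_eq_0_iff:
  assumes "\<not> 2 dvd x"
  shows "log_2adic (princ x) = 0 \<longleftrightarrow> x = teich x"
  using log_2adic_eq_0_iff[OF princ_near_1[OF assms]] teich_props(1)[OF assms]
  by (auto simp: princ_def)

lemma not_two_dvd_pm1: "\<not> 2 dvd (1 :: two_adic_int)" "\<not> 2 dvd (- 1 :: two_adic_int)"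
  using two_power_dvd_of_nat_iff[of 1 1] by auto

lemma teich_pm1: "x \<in> {1, - 1} \<Longrightarrow> teich x = x"
  using not_two_dvd_pm1 by (intro teich_eqI) auto

lemma princ_pow_pm1: "x \<in> {1, - 1} \<Longrightarrow> princ_pow x z = 1"
proof -
  assume "x \<in> {1, - 1}"
  then have "log_2adic (princ x) = 0"
    using log_princ_eq_0_iff[of x] not_two_dvd_pm1 teich_pm1[of x] by auto
  then show ?thesis by (simp add: princ_pow_def)
qed

text \<open>
  With \<open>a = log \<langle>x\<rangle>\<close> and \<open>b = log \<langle>y\<rangle>\<close> the two equations become \<open>b = x ^ n * a\<close> and \<open>a = y ^ n * b\<close>.
  If \<open>a\<close> were not 0, then \<open>(x * y) ^ n = 1\<close>; the logarithm of this equation is \<open>n * (a + b) = 0\<close>, so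
  \<open>b = - a\<close> and \<open>x ^ n = -1\<close>. The logarithm of the square of the latter gives \<open>2 * n * a = 0\<close>, a
  contradiction. So both principal parts are 1, and \<open>x\<close> and \<open>y\<close> are equal to their common sign.
\<close>

lemma two_adic_solutions:
  fixes x y :: two_adic_int
  assumes n: "n > 0" and x: "\<not> 2 dvd x" and y: "\<not> 2 dvd y"
    and xy: "to_two_adic (teich x) * princ_pow x (x ^ n) = to_two_adic y"
    and yx: "to_two_adic (teich y) * princ_pow y (y ^ n) = to_two_adic x"
  shows "(x, y) \<in> {(1, 1), (- 1, - 1)}"
proof -
  define a b where "a = log_2adic (princ x)" and "b = log_2adic (princ y)"
  note p = princ_near_1[OF x] princ_near_1[OF y]
  have teich: "teich y = teich x" and b: "b = to_two_adic x ^ n * a"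
    using log_princ_of_solution[OF x y xy] by (simp_all add: a_def b_def)
  have a: "a = to_two_adic y ^ n * b"
    using log_princ_of_solution[OF y x yx] by (simp add: a_def b_def)
  have w: "teich x \<in> {1, - 1}" by (rule teich_props(1)[OF x])
  have "a = 0"
  proof (rule ccontr)
    assume a0: "a \<noteq> 0"
    have "a * (to_two_adic x * to_two_adic y) ^ n = a * 1"
      using a b by (simp add: power_mult_distrib mult_ac)
    then have "(to_two_adic x * to_two_adic y) ^ n = 1" using a0 by (metis mult_left_cancel)
    \<comment> \<open>The signs of \<open>x\<close> and \<open>y\<close> agree, so they cancel in the product.\<close>
    moreover have "princ x * princ y = to_two_adic x * to_two_adic y"
      using w by (auto simp: princ_def teich)
    ultimately have "log_2adic ((princ x * princ y) ^ n) = 0"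
      using log_2adic_eq_0_iff[of 1] by simp
    then have "of_nat n * (a + b) = 0"
      using p log_2adic_power[OF fract_absval_mult_minus_1_le[OF p]] log_2adic_mult[OF p]
      by (simp add: a_def b_def)
    then have "a + b = 0" using n by simp
    then have "a * to_two_adic x ^ n = a * - 1" using b by (simp add: mult.commute add_eq_0_iff)
    then have xn: "to_two_adic x ^ n = - 1" using a0 by (metis mult_left_cancel)
    \<comment> \<open>Squaring removes the sign and turns \<open>-1\<close> into 1.\<close>
    have "(princ x)\<^sup>2 = (to_two_adic x)\<^sup>2" using w by (auto simp: princ_def)
    then have "princ x ^ (2 * n) = (to_two_adic x ^ n)\<^sup>2"
      by (metis power_mult power_mult mult.commute)
    then have "log_2adic (princ x ^ (2 * n)) = 0"
      using log_2adic_eq_0_iff[of 1] by (simp add: xn)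
    then have "of_nat (2 * n) * a = 0" using log_2adic_power[OF p(1), of "2 * n"] by (simp only: a_def)
    then have "of_nat (2 * n) = (0 :: two_adic)" using a0 by (simp only: mult_eq_0_iff) simp
    then show False using n by (simp only: of_nat_two_adic_eq_0_iff)
  qed
  then have "b = 0" using b by simp
  have "x = teich x" "y = teich x"
    using \<open>a = 0\<close> \<open>b = 0\<close> log_princ_eq_0_iff[OF x] log_princ_eq_0_iff[OF y] teich
    by (simp_all add: a_def b_def)
  then show ?thesis using w by auto
qed


section \<open>The count and the 2-adic solutions together\<close>

theorem corollary19:
  fixes n :: nat
  assumes "n > 0"
  shows
    "(\<not> 2 dvd n \<longrightarrow> (\<forall>e\<ge>1. num_solutions n e =
        (if e = 1 then 1
         else if e \<le> 4 then 2 * 2 ^ (e - 2)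
         else 2 ^ ((e + 1) div 2) + 2 ^ (e div 3 + (e + 1) div 3)))) \<and>
     (2 dvd n \<longrightarrow> (\<forall>e\<ge>1. num_solutions n e =
        (if e = 1 then 1
         else if e \<le> multiplicity 2 n + 4 then 2 * 2 ^ (e - 2)
         else 2 * 2 ^ ((e + multiplicity 2 n + 1) div 2)))) \<and>
     {(x :: two_adic_int, y :: two_adic_int).
        \<not> 2 dvd x \<and> \<not> 2 dvd y \<and>
        to_two_adic (teich x) * princ_pow x (x ^ n) = to_two_adic y \<and>
        to_two_adic (teich y) * princ_pow y (y ^ n) = to_two_adic x}
       = {(1, 1), (- 1, - 1)}"
proof (intro conjI)
  show "\<not> 2 dvd n \<longrightarrow> (\<forall>e\<ge>1. num_solutions n e =
      (if e = 1 then 1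
       else if e \<le> 4 then 2 * 2 ^ (e - 2)
       else 2 ^ ((e + 1) div 2) + 2 ^ (e div 3 + (e + 1) div 3)))"
    using num_solutions_odd by blast
  show "2 dvd n \<longrightarrow> (\<forall>e\<ge>1. num_solutions n e =
      (if e = 1 then 1
       else if e \<le> multiplicity 2 n + 4 then 2 * 2 ^ (e - 2)
       else 2 * 2 ^ ((e + multiplicity 2 n + 1) div 2)))"
    using num_solutions_even assms by blast
  show "{(x :: two_adic_int, y :: two_adic_int).
      \<not> 2 dvd x \<and> \<not> 2 dvd y \<and>
      to_two_adic (teich x) * princ_pow x (x ^ n) = to_two_adic y \<and>
      to_two_adic (teich y) * princ_pow y (y ^ n) = to_two_adic x}
    = {(1, 1), (- 1, - 1)}" (is "?S = ?T")
  proof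
    show "?S \<subseteq> ?T" using two_adic_solutions[OF assms] by blast
    show "?T \<subseteq> ?S" using not_two_dvd_pm1 by (auto simp: teich_pm1 princ_pow_pm1)
  qed
qed

end
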